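(* The topological space $\overline{X}$ is contractible.
   Context: Setting. $K$ is a finite extension of $\mathbb{Q}_p$ with valuation $v$ normalized so that a prime element has valuation $1$ (and $v(0)=\infty$); $V$ is an $n$-dimensional $K$-vector space with fixed basis $v_1,\dots,v_n$; $\underline{n}=\{1,\dots,n\}$. $G=PGL(V)$ denotes the group of $K$-rational points, with its $p$-adic topology. $T\subseteq G$ is the image of the diagonal matrices, $N\subseteq G$ is its normalizer, i.e. the image of the monomial matrices; $N=T\rtimes W$ with $W$ the group of permutation matrices, $w(v_i)=v_{w(i)}$. $\Lambda=X_*(T)\otimes\mathbb{R}=\sum_{i=1}^n\mathbb{R}\eta_i$ subject to the single relation $\sum_i\eta_i=0$. Roots: $\Phi=\{a_{ij}:i\neq j\}$, $a_{ij}(\sum x_k\eta_k)=x_i-x_j$. Compactified apartment. For nonempty $I\subseteq\underline{n}$ let $\Lambda_I=\sum_{i\in I}\mathbb{R}\eta_i^I$ with the single relation $\sum_{i\in I}\eta_i^I=0$, and $r_I:\Lambda\to\Lambda_I$, $r_I(\sum_{i=1}^n x_i\eta_i)=\sum_{i\in I}x_i\eta_i^I$; $\Lambda_{\underline{n}}=\Lambda$. $\overline{\Lambda}$ is the disjoint union $\bigcup_{\emptyset\ne I\subseteq\underline{n}}\Lambda_I$, with topology having as base the open subsets of $\Lambda$ together with the sets $C_U^I=(U+D_I)\cup\bigcup_{I\subseteq J\subsetneq\underline{n}}r_J(U+D_I)$ for nonempty $I\subsetneq\underline{n}$ and bounded open $U\subseteq\Lambda$, where $D_I=\sum_{i\notin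 I}\mathbb{R}_{\ge0}(-\eta_i)$. $N$ acts on $\overline{\Lambda}$ via $\nu$: $w\in W$ maps $\Lambda_I$ to $\Lambda_{w(I)}$ linearly by $\eta_i^I\mapsto\eta_{w(i)}^{w(I)}$, and $t\in T$ induced by $\mathrm{diag}(t_1,\dots,t_n)$ acts on $\Lambda_I$ by translation by $-\sum_{i\in I}v(t_i)\eta_i^I$. Groups. For $a=a_{ij}$, $U_a\subseteq G$ is the image of the group of unipotent matrices $v_j\mapsto v_j+\omega v_i$, $v_l\mapsto v_l$ ($l\ne j$), $\omega\in K$; $\psi_a(u)=v(\omega)$. For $x\in\overline{\Lambda}$, $f_x(a)=\inf\{t\in\mathbb{R}: x\in\overline{\{z\in\Lambda:a(z)\ge -t\}}\}$ (closure in $\overline{\Lambda}$; $\inf\emptyset=\infty$, $\inf\mathbb{R}=-\infty$), $U_{a,x}=\{u\in U_a:\psi_a(u)\ge f_x(a)\}$ (so it is $\{1\}$ if $f_x(a)=\infty$ and $U_a$ if $f_x(a)=-\infty$), $U_x$ is the subgroup of $G$ generated by all $U_{a,x}$, $a\in\Phi$; $N_x=\{n\in N:\nu(n)x=x\}$; $P_x=U_xN_x$ (a group). $Z\subseteq T$ is the subgroup of elements acting trivially on $\Lambda$, and $U_0^\wedge=U_0Z$, where $U_0=U_x$ for $x=0\in\Lambda$; it is a compact subgroup of $G$. Compactified building. $\overline{X}=(U_0^\wedge\times\overline{\Lambda})/\!\sim$ with the quotient topology, where $(g,x)\sim(h,y)$ iff there is $n\in N$ with $\nu(n)x=y$ and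 $g^{-1}hn\in P_x$. *)

theory Defs
  imports
    "HOL-Analysis.Analysis"
    "HOL-Algebra.Algebra"
begin

section \<open>Finite extensions of the field of p-adic numbers\<close>

definition padic_valuation :: "nat \<Rightarrow> rat \<Rightarrow> ereal" where
  "padic_valuation p q =
     (if q = 0 then \<infinity>
      else ereal (real (multiplicity (int p) (fst (quotient_of q))) -
                  real (multiplicity (int p) (snd (quotient_of q)))))"

definition padic_Cauchy :: "nat \<Rightarrow> (nat \<Rightarrow> rat) set" where
  "padic_Cauchy p =
     {q. \<forall>m::nat. \<exists>N. \<forall>i\<ge>N. \<forall>j\<ge>N. padic_valuation p (q i - q j) \<ge> ereal (real m)}"

definition padic_null :: "nat \<Rightarrow> (nat \<Rightarrow> rat) set" where
  "padic_null p =
     {q. \<forall>m::nat. \<exists>N. \<forall>i\<ge>N. padic_valuation p (q i) \<ge> ereal (real m)}"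

definition padic_Cauchy_ring :: "nat \<Rightarrow> (nat \<Rightarrow> rat) ring" where
  "padic_Cauchy_ring p =
     \<lparr>carrier = padic_Cauchy p, mult = (\<lambda>q r i. q i * r i), one = (\<lambda>i. 1),
      ring.zero = (\<lambda>i. 0), add = (\<lambda>q r i. q i + r i)\<rparr>"

definition Qp :: "nat \<Rightarrow> (nat \<Rightarrow> rat) set ring" where
  "Qp p = padic_Cauchy_ring p Quot padic_null p"

text \<open>
  The type of \<^term>\<open>v\<close> carries the field \<open>K\<close>, which is a finite extension of \<open>Q\<^sub>p\<close> via some
  embedding \<open>\<iota>\<close>; the value \<open>\<infinity>\<close> is taken at \<open>0\<close> only, all other values are integers, and
  \<open>1\<close> is a value (normalization). On a finite extension of \<open>Q\<^sub>p\<close> these conditions determine \<open>v\<close>.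
\<close>

locale padic_field =
  fixes p :: nat and v :: "'k::field \<Rightarrow> ereal"
  assumes prime_p: "Factorial_Ring.prime p"
    and finite_extension:
      "\<exists>\<iota> \<in> ring_hom (Qp p) (ring_of_type_algebra :: 'k ring).
         ring.finite_dimension (ring_of_type_algebra :: 'k ring) (\<iota> ` carrier (Qp p)) UNIV"
    and v_zero: "v 0 = \<infinity>"
    and v_int: "x \<noteq> 0 \<Longrightarrow> \<exists>m::int. v x = ereal (real_of_int m)"
    and v_mult: "v (x * y) = v x + v y"
    and v_add: "min (v x) (v y) \<le> v (x + y)"
    and v_padic: "0 < v (of_nat p)"
    and v_normalized: "\<exists>\<pi>. v \<pi> = 1"


section \<open>Final topologies\<close>

definition quotient_topology :: "'a topology \<Rightarrow> ('a \<Rightarrow> 'b) \<Rightarrow> 'b topology" where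
  "quotient_topology T f =
     topology (\<lambda>U. U \<subseteq> f ` topspace T \<and> openin T {x \<in> topspace T. f x \<in> U})"

lemma openin_quotient_topology:
  "openin (quotient_topology T f) U \<longleftrightarrow>
     U \<subseteq> f ` topspace T \<and> openin T {x \<in> topspace T. f x \<in> U}"
proof -
  have "istopology (\<lambda>U. U \<subseteq> f ` topspace T \<and> openin T {x \<in> topspace T. f x \<in> U})"
    unfolding istopology_def
  proof (intro conjI allI impI)
    fix S1 S2
    assume S1: "S1 \<subseteq> f ` topspace T \<and> openin T {x \<in> topspace T. f x \<in> S1}"
      and S2: "S2 \<subseteq> f ` topspace T \<and> openin T {x \<in> topspace T. f x \<in> S2}"
    show "S1 \<inter> S2 \<subseteq> f ` topspace T" using S1 by blast
    have "{x \<in> topspace T. f x \<in> S1 \<inter> S2} = {x \<in> topspace T. f x \<in> S1} \<inter> {x \<in> topspace T. f x \<in> S2}"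
      by blast
    then show "openin T {x \<in> topspace T. f x \<in> S1 \<inter> S2}" using S1 S2 by (simp add: openin_Int)
  next
    fix \<K>
    assume K: "\<forall>S1\<in>\<K>. S1 \<subseteq> f ` topspace T \<and> openin T {x \<in> topspace T. f x \<in> S1}"
    show "\<Union> \<K> \<subseteq> f ` topspace T" using K by blast
    have "{x \<in> topspace T. f x \<in> \<Union> \<K>} = (\<Union>S1\<in>\<K>. {x \<in> topspace T. f x \<in> S1})"
      by blast
    then show "openin T {x \<in> topspace T. f x \<in> \<Union> \<K>}" using K by auto
  qed
  then show ?thesis by (simp add: quotient_topology_def topology_inverse')
qed

lemma quotient_map_quotient_topology: "quotient_map T (quotient_topology T f) f"
proof -
  have "{x \<in> topspace T. f x \<in> f ` topspace T} = topspace T"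
    by blast
  then have "openin (quotient_topology T f) (f ` topspace T)"
    by (simp add: openin_quotient_topology)
  then have "topspace (quotient_topology T f) = f ` topspace T"
    by (metis openin_quotient_topology openin_subset openin_topspace subset_antisym)
  then show ?thesis by (auto simp: quotient_map_def openin_quotient_topology)
qed


section \<open>The group PGL(V) and its topology\<close>

text \<open>
  \<open>V\<close> is identified with \<open>K\<^sup>n\<close> by means of its fixed basis, which is indexed by the finite
  type \<open>'n\<close>. The image of the basis vector \<open>v\<^sub>j\<close> is the \<open>j\<close>-th column of a matrix.
\<close>

definition GL :: "('k::field^'n^'n) monoid" where
  "GL = \<lparr>carrier = {A. invertible A}, mult = (**), one = mat 1\<rparr>"

definition scalars :: "('k::field^'n^'n) set" where
  "scalars = {mat c | c. c \<noteq> 0}"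

definition PGL :: "('k::field^'n^'n) set monoid" where
  "PGL = GL Mod scalars"

definition proj :: "'k::field^'n^'n \<Rightarrow> ('k^'n^'n) set" where
  "proj A = scalars #>\<^bsub>GL\<^esub> A"

definition field_topology :: "('k::field \<Rightarrow> ereal) \<Rightarrow> 'k topology" where
  "field_topology v = topology_generated_by {{y. ereal (real_of_int m) \<le> v (y - x)} | x m. True}"

definition matrix_topology :: "('k::field \<Rightarrow> ereal) \<Rightarrow> ('k^'n^'n) topology" where
  "matrix_topology v =
     pullback_topology UNIV (\<lambda>A (i, j). A $ i $ j)
       (product_topology (\<lambda>_. field_topology v) (UNIV :: ('n \<times> 'n) set))"

definition PGL_topology :: "('k::field \<Rightarrow> ereal) \<Rightarrow> ('k^'n^'n) set topology" where
  "PGL_topology v = quotient_topology (subtopology (matrix_topology v) (carrier GL)) proj"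

definition diag_mat :: "('n \<Rightarrow> 'k::field) \<Rightarrow> 'k^'n^'n" where
  "diag_mat t = (\<chi> i j. if i = j then t i else 0)"

definition perm_mat :: "('n \<Rightarrow> 'n) \<Rightarrow> 'k::field^'n^'n" where
  "perm_mat w = (\<chi> i j. if i = w j then 1 else 0)"

definition elem_mat :: "'n \<Rightarrow> 'n \<Rightarrow> 'k::field \<Rightarrow> 'k^'n^'n" where
  "elem_mat i j \<omega> = (\<chi> k l. if k = l then 1 else if k = i \<and> l = j then \<omega> else 0)"

definition torus :: "('k::field^'n^'n) set set" where
  "torus = {proj (diag_mat t) | t. \<forall>i. t i \<noteq> 0}"

definition monomial_group :: "('k::field^'n^'n) set set" where
  "monomial_group = {proj (diag_mat t ** perm_mat w) | t w. (\<forall>i. t i \<noteq> 0) \<and> bij w}"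


section \<open>The compactified apartment\<close>

text \<open>
  A point of \<open>\<Lambda>\<^sub>I\<close> is encoded as a pair whose first component is \<open>I\<close> and whose second component is
  the set of all vectors \<open>y\<close> for which \<open>\<Sum>\<^bsub>i\<in>I\<^esub> y\<^sub>i \<eta>\<^sub>i\<^sup>I\<close> is this point: the coordinates
  in \<open>I\<close> matter only up to a common additive constant, the coordinates outside of \<open>I\<close> do not matter.
\<close>

type_synonym 'n apt_point = "'n set \<times> (real^'n) set"

definition pt :: "'n set \<Rightarrow> real^'n \<Rightarrow> 'n apt_point" where
  "pt I x = (I, {y. \<exists>c. \<forall>i\<in>I. y $ i = x $ i + c})"

definition piece :: "'n::finite set \<Rightarrow> 'n apt_point set" where
  "piece I = range (pt I)"

abbreviation apartment :: "'n::finite apt_point set" where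
  "apartment \<equiv> piece UNIV"

definition cpt_apartment :: "'n::finite apt_point set" where
  "cpt_apartment = (\<Union>I\<in>{I. I \<noteq> {}}. piece I)"

definition restr :: "'n::finite set \<Rightarrow> 'n apt_point \<Rightarrow> 'n apt_point" where
  "restr I z = (I, {y. \<exists>x \<in> snd z. \<exists>c. \<forall>i\<in>I. y $ i = x $ i + c})"

definition eta :: "'n \<Rightarrow> real^'n" where
  "eta i = axis i 1"

definition cone :: "'n set \<Rightarrow> (real^'n) set" where
  "cone I = {\<Sum>i\<in>-I. s i *\<^sub>R (- eta i) | s. \<forall>i. 0 \<le> s i}"

definition add_cone :: "'n::finite apt_point set \<Rightarrow> 'n set \<Rightarrow> 'n apt_point set" where
  "add_cone U I = {pt UNIV (x + d) | x d. pt UNIV x \<in> U \<and> d \<in> cone I}"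

text \<open>
  \<open>\<Lambda>\<close> is the quotient of the vector space \<^typ>\<open>real^'n\<close> by a line, with quotient map \<^term>\<open>pt UNIV\<close>;
  its open sets and its bounded sets are those of this finite-dimensional quotient vector space.
\<close>

definition open_in_apartment :: "'n::finite apt_point set \<Rightarrow> bool" where
  "open_in_apartment U \<longleftrightarrow> U \<subseteq> apartment \<and> open {x. pt UNIV x \<in> U}"

definition bounded_in_apartment :: "'n::finite apt_point set \<Rightarrow> bool" where
  "bounded_in_apartment U \<longleftrightarrow> (\<exists>B. bounded B \<and> U \<subseteq> pt UNIV ` B)"

definition corner :: "'n::finite set \<Rightarrow> 'n apt_point set \<Rightarrow> 'n apt_point set" where
  "corner I U = add_cone U I \<union> (\<Union>J\<in>{J. I \<subseteq> J \<and> J \<subset> UNIV}. restr J ` add_cone U I)"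

definition cpt_apartment_topology :: "'n::finite apt_point topology" where
  "cpt_apartment_topology =
     topology_generated_by
       ({U. open_in_apartment U} \<union>
        {corner I U | I U. I \<noteq> {} \<and> I \<subset> UNIV \<and> open_in_apartment U \<and> bounded_in_apartment U})"

definition perm_act :: "('n::finite \<Rightarrow> 'n) \<Rightarrow> 'n apt_point \<Rightarrow> 'n apt_point" where
  "perm_act w z = (w ` fst z, {y. (\<chi> i. y $ w i) \<in> snd z})"

definition torus_act ::
  "('k::field \<Rightarrow> ereal) \<Rightarrow> ('n::finite \<Rightarrow> 'k) \<Rightarrow> 'n apt_point \<Rightarrow> 'n apt_point" where
  "torus_act v t z =
     (fst z, (\<lambda>x. x - (\<Sum>i\<in>fst z. real_of_ereal (v (t i)) *\<^sub>R eta i)) ` snd z)"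

text \<open>
  The pair \<open>(t, w)\<close> is determined by the element \<open>g\<close> of \<open>N\<close> up to scaling of \<open>t\<close>,
  and scalars act trivially, so the following description is unambiguous.
\<close>

definition nu ::
  "('k::field \<Rightarrow> ereal) \<Rightarrow> ('k^'n^'n) set \<Rightarrow> 'n apt_point \<Rightarrow> 'n apt_point" where
  "nu v g z =
     (THE z'. \<exists>t w. (\<forall>i. t i \<noteq> 0) \<and> bij w \<and> g = proj (diag_mat t ** perm_mat w) \<and>
                    z' = torus_act v t (perm_act w z))"


section \<open>The groups attached to points of the compactified apartment\<close>

definition half_apartment :: "'n::finite \<Rightarrow> 'n \<Rightarrow> real \<Rightarrow> 'n apt_point set" where
  "half_apartment i j t = {pt UNIV x | x. x $ i - x $ j \<ge> - t}"

definition root_fun :: "'n::finite apt_point \<Rightarrow> 'n \<Rightarrow> 'n \<Rightarrow> ereal" where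
  "root_fun x i j =
     Inf (ereal ` {t. x \<in> cpt_apartment_topology closure_of half_apartment i j t})"

text \<open>
  An element of the root group of \<open>a\<^bsub>ij\<^esub>\<close> has a unique parameter \<open>\<omega>\<close>, and its valuation
  \<open>\<psi>\<close> is \<^term>\<open>v \<omega>\<close>. For \<^term>\<open>root_fun x i j = \<infinity>\<close> only \<^term>\<open>\<omega> = 0\<close> remains.
\<close>

definition root_subgroup ::
  "('k::field \<Rightarrow> ereal) \<Rightarrow> 'n apt_point \<Rightarrow> 'n \<Rightarrow> 'n \<Rightarrow> ('k^'n^'n) set set" where
  "root_subgroup v x i j = {proj (elem_mat i j \<omega>) | \<omega>. root_fun x i j \<le> v \<omega>}"

definition U_pt :: "('k::field \<Rightarrow> ereal) \<Rightarrow> 'n apt_point \<Rightarrow> ('k^'n^'n) set set" where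
  "U_pt v x = generate PGL (\<Union>(i, j)\<in>{(i, j). i \<noteq> j}. root_subgroup v x i j)"

definition N_pt :: "('k::field \<Rightarrow> ereal) \<Rightarrow> 'n apt_point \<Rightarrow> ('k^'n^'n) set set" where
  "N_pt v x = {g \<in> monomial_group. nu v g x = x}"

definition P_pt :: "('k::field \<Rightarrow> ereal) \<Rightarrow> 'n apt_point \<Rightarrow> ('k^'n^'n) set set" where
  "P_pt v x = U_pt v x <#>\<^bsub>PGL\<^esub> N_pt v x"

definition Z_group :: "('k::field \<Rightarrow> ereal) \<Rightarrow> ('k^'n^'n) set set" where
  "Z_group v = {g \<in> torus. \<forall>z\<in>apartment. nu v g z = z}"

definition U0_hat :: "('k::field \<Rightarrow> ereal) \<Rightarrow> ('k^'n^'n) set set" where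
  "U0_hat v = U_pt v (pt UNIV 0) <#>\<^bsub>PGL\<^esub> Z_group v"


section \<open>The compactified building\<close>

definition building_rel ::
  "('k::field \<Rightarrow> ereal) \<Rightarrow>
     ((('k^'n^'n) set \<times> 'n apt_point) \<times> (('k^'n^'n) set \<times> 'n apt_point)) set" where
  "building_rel v =
     {((g, x), (h, y)). g \<in> U0_hat v \<and> x \<in> cpt_apartment \<and> h \<in> U0_hat v \<and> y \<in> cpt_apartment \<and>
        (\<exists>m\<in>monomial_group. nu v m x = y \<and> inv\<^bsub>PGL\<^esub> g \<otimes>\<^bsub>PGL\<^esub> h \<otimes>\<^bsub>PGL\<^esub> m \<in> P_pt v x)}"

definition compactified_building ::
  "('k::field \<Rightarrow> ereal) \<Rightarrow> (('k^'n^'n) set \<times> 'n apt_point) set topology" where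
  "compactified_building v =
     quotient_topology
       (prod_topology (subtopology (PGL_topology v) (U0_hat v)) cpt_apartment_topology)
       (\<lambda>a. building_rel v `` {a})"

end

theory Submission
  imports Defs
begin

text \<open>
  In homogeneous coordinates \<open>a\<close>, normalized to maximum \<open>1\<close>, the compactified apartment is a
  union of faces of the unit cube, and raising all coordinates of a point to at least \<open>s\<close>, for
  \<open>s\<close> from \<open>0\<close> to \<open>1\<close>, contracts it to the origin \<open>(1, \<dots>, 1)\<close>.
  The elements of \<open>U\<^sub>x\<close> are represented by matrices \<open>B\<close> that, together with their inverse,
  satisfy \<open>\<bar>B\<^sub>i\<^sub>j\<bar> a\<^sub>j \<le> a\<^sub>i\<close>. A matrix that also has integral entries satisfies the same inequality
  for the coordinates \<open>max a\<^sub>i s\<close>. Conversely, by Gaussian elimination with pivots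
  of maximal relative size, matrices subject to these inequalities for positive coordinates lie in
  \<open>P\<^sub>x\<close>. Hence the contraction of the apartment respects the equivalence relation, and it descends to
  the quotient because the interval is locally compact.
\<close>

text \<open>The difficulty is the monomial element in the definition of the relation: truncation at
  \<open>s\<close> does not commute with the action of a general torus element, so the witness for
  two equivalent pairs cannot be kept while their points are moved. The way out is that both group
  components come from \<open>U0_hat\<close>. A matrix \<open>A\<close> representing the quotient of
  the two components and its inverse are integral, and each has entries of absolute value
  \<open>1\<close> in the positions of some permutation. Together with the inequalities relating
  \<open>A\<close> to the two points, this bounds the coordinates of either point by permuted
  coordinates of the other; comparing sums turns the bounds into equalities. So the two points,
  suitably scaled, differ only by a permutation of coordinates, and a permutation matrix, whose
  action does commute with truncation, takes over as the witness. That it is one is then read off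
  from the inequalities for the truncated points.\<close>

section \<open>Coordinates on the compactified apartment\<close>

text \<open>
  Homogeneous coordinates: the point of \<open>\<Lambda>\<^sub>I\<close> with coordinates \<open>x\<^sub>i\<close> is described by
  \<open>a\<^sub>i = exp x\<^sub>i\<close> for \<open>i \<in> I\<close> and \<open>a\<^sub>i = 0\<close> otherwise, up to a positive factor.
\<close>

definition hpt :: "real^'n \<Rightarrow> 'n::finite apt_point" where
  "hpt a = pt {i. 0 < a $ i} (\<chi> i. ln (a $ i))"

definition orthant :: "(real^'n::finite) set" where
  "orthant = {a. a \<noteq> 0 \<and> (\<forall>i. 0 \<le> a $ i)}"

text \<open>The maximum norm is the normalization that survives truncation: a coordinate equal to
  \<open>1\<close> stays \<open>1\<close> when all coordinates are raised to a level
  \<open>s \<le> 1\<close>.\<close>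

definition cube_face :: "(real^'n::finite) set" where
  "cube_face = {a. infnorm a = 1 \<and> (\<forall>i. 0 \<le> a $ i)}"

lemma cube_face_orthant: "a \<in> cube_face \<Longrightarrow> a \<in> orthant"
  by (auto simp: cube_face_def orthant_def infnorm_0)

lemma orthant_pos: "a \<in> orthant \<Longrightarrow> {i. 0 < a $ i} \<noteq> {}"
  by (auto simp: orthant_def vec_eq_iff less_le)

lemma infnorm_normalize:
  assumes "a \<in> orthant" shows "a /\<^sub>R infnorm a \<in> cube_face"
proof -
  have "infnorm a > 0" using assms by (simp add: orthant_def infnorm_pos_lt)
  then show ?thesis using assms
    by (auto simp: cube_face_def orthant_def infnorm_mul)
qed

lemma infnorm_attained:
  fixes a :: "real^'n::finite" obtains i where "infnorm a = \<bar>a $ i\<bar>"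
proof -
  have "infnorm a = Sup (range (\<lambda>i. \<bar>a $ i\<bar>))" by (simp add: infnorm_cart full_SetCompr_eq)
  also have "\<dots> = Max (range (\<lambda>i. \<bar>a $ i\<bar>))" by (rule cSup_eq_Max) auto
  also have "\<dots> \<in> range (\<lambda>i. \<bar>a $ i\<bar>)" by (rule Max_in) auto
  finally show ?thesis using that by blast
qed

lemma cube_face_iff:
  fixes a :: "real^'n::finite"
  shows "a \<in> cube_face \<longleftrightarrow> (\<forall>i. 0 \<le> a $ i \<and> a $ i \<le> 1) \<and> (\<exists>i. a $ i = 1)"
proof
  assume a: "a \<in> cube_face"
  obtain i where i: "infnorm a = \<bar>a $ i\<bar>" by (rule infnorm_attained)
  show "(\<forall>i. 0 \<le> a $ i \<and> a $ i \<le> 1) \<and> (\<exists>i. a $ i = 1)"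
  proof (intro conjI allI exI)
    fix j show "0 \<le> a $ j" "a $ j \<le> 1"
      using a component_le_infnorm_cart[of a j] by (auto simp: cube_face_def)
    show "a $ i = 1" using a i unfolding cube_face_def by (metis (mono_tags, lifting) abs_of_nonneg mem_Collect_eq)
  qed
next
  assume a: "(\<forall>i. 0 \<le> a $ i \<and> a $ i \<le> 1) \<and> (\<exists>i. a $ i = 1)"
  obtain i where i: "infnorm a = \<bar>a $ i\<bar>" by (rule infnorm_attained)
  obtain j where j: "a $ j = 1" using a by blast
  have "infnorm a = 1" using i j a component_le_infnorm_cart[of a j]
    by (metis abs_of_nonneg order_antisym)
  then show "a \<in> cube_face" using a by (auto simp: cube_face_def)
qed

lemma pt_eq_iff: "pt I x = pt J y \<longleftrightarrow> I = J \<and> (\<exists>c. \<forall>i\<in>I. x $ i = y $ i + c)"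
proof
  assume *: "pt I x = pt J y"
  have "x \<in> snd (pt I x)" by (auto simp: pt_def intro: exI[of _ 0])
  then have "x \<in> snd (pt J y)" using * by simp
  then show "I = J \<and> (\<exists>c. \<forall>i\<in>I. x $ i = y $ i + c)" using * by (auto simp: pt_def)
next
  assume *: "I = J \<and> (\<exists>c. \<forall>i\<in>I. x $ i = y $ i + c)"
  then obtain c where c: "\<And>i. i \<in> I \<Longrightarrow> x $ i = y $ i + c" by blast
  have "(\<exists>d. \<forall>i\<in>I. z $ i = x $ i + d) \<longleftrightarrow> (\<exists>d. \<forall>i\<in>I. z $ i = y $ i + d)" for z
  proof
    assume "\<exists>d. \<forall>i\<in>I. z $ i = x $ i + d"
    then obtain d where "\<forall>i\<in>I. z $ i = x $ i + d" by blast
    then show "\<exists>d. \<forall>i\<in>I. z $ i = y $ i + d" by (intro exI[of _ "c + d"]) (simp add: c)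
  next
    assume "\<exists>d. \<forall>i\<in>I. z $ i = y $ i + d"
    then obtain d where "\<forall>i\<in>I. z $ i = y $ i + d" by blast
    then show "\<exists>d. \<forall>i\<in>I. z $ i = x $ i + d" by (intro exI[of _ "d - c"]) (simp add: c)
  qed
  then show "pt I x = pt J y" using * by (simp add: pt_def)
qed

lemma hpt_scale: "c > 0 \<Longrightarrow> hpt (c *\<^sub>R a) = hpt a"
  unfolding hpt_def pt_eq_iff by (auto simp: zero_less_mult_iff ln_mult intro: exI[of _ "ln c"])

lemma pt_eq_hpt: "pt I x = hpt (\<chi> i. if i \<in> I then exp (x $ i) else 0)"
  by (auto simp: hpt_def pt_eq_iff intro: exI[of _ 0])

lemma hpt_eq_iff:
  assumes "a \<in> orthant" "b \<in> orthant"
  shows "hpt a = hpt b \<longleftrightarrow> (\<exists>c>0. b = c *\<^sub>R a)"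
proof
  assume "hpt a = hpt b"
  then obtain c where I: "{i. 0 < a $ i} = {i. 0 < b $ i}"
    and c: "\<And>i. 0 < a $ i \<Longrightarrow> ln (a $ i) = ln (b $ i) + c"
    by (auto simp: hpt_def pt_eq_iff)
  have "b $ i = exp (- c) * a $ i" for i
  proof (cases "0 < a $ i")
    case True
    then have "0 < b $ i" using I by auto
    then have "ln (b $ i) = ln (exp (- c) * a $ i)" using c[OF True] True by (simp add: ln_mult)
    then show ?thesis using True \<open>0 < b $ i\<close> by (simp add: ln_inj_iff)
  next
    case False
    then have "\<not> 0 < b $ i" using I by auto
    then have "a $ i = 0" "b $ i = 0" using False assms by (auto simp: orthant_def not_less order_antisym)
    then show ?thesis by simp
  qed
  then have "b = exp (- c) *\<^sub>R a" by (simp add: vec_eq_iff)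
  then show "\<exists>c>0. b = c *\<^sub>R a" by (intro exI[of _ "exp (- c)"]) simp
qed (auto simp: hpt_scale)

lemma inj_on_hpt: "inj_on hpt cube_face"
proof (rule inj_onI)
  fix a b :: "real^'n" assume *: "a \<in> cube_face" "b \<in> cube_face" "hpt a = hpt b"
  then obtain c where c: "c > 0" "b = c *\<^sub>R a" using hpt_eq_iff cube_face_orthant by blast
  then have "infnorm b = c * infnorm a" by (simp add: infnorm_mul)
  then show "a = b" using * c by (simp add: cube_face_def)
qed

lemma pt_in_cpt_apartment: "I \<noteq> {} \<Longrightarrow> pt I x \<in> cpt_apartment"
  unfolding cpt_apartment_def piece_def by (rule UN_I[of I]) auto

lemma hpt_in_cpt_apartment: "a \<in> orthant \<Longrightarrow> hpt a \<in> cpt_apartment"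
  unfolding hpt_def by (rule pt_in_cpt_apartment) (rule orthant_pos)

lemma hpt_cube_face: "hpt ` cube_face = cpt_apartment"
proof
  show "hpt ` cube_face \<subseteq> cpt_apartment"
    using hpt_in_cpt_apartment cube_face_orthant by blast
  show "cpt_apartment \<subseteq> hpt ` (cube_face :: (real^'a) set)"
  proof
    fix z :: "'a apt_point" assume "z \<in> cpt_apartment"
    then obtain I x where z: "z = pt I x" "I \<noteq> {}" by (auto simp: cpt_apartment_def piece_def)
    define a where "a = (\<chi> i. if i \<in> I then exp (x $ i) else 0)"
    obtain i where "i \<in> I" using z by blast
    then have "a $ i \<noteq> 0" by (simp add: a_def)
    then have "a \<noteq> 0" by auto
    then have a: "a \<in> orthant" by (simp add: orthant_def a_def)
    then have "infnorm a > 0" by (simp add: orthant_def infnorm_pos_lt)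
    then have "z = hpt (a /\<^sub>R infnorm a)" by (simp add: z pt_eq_hpt a_def hpt_scale)
    then show "z \<in> hpt ` cube_face" using infnorm_normalize[OF a] by blast
  qed
qed

section \<open>Corner sets in homogeneous coordinates\<close>

lemma cone_iff: "d \<in> cone I \<longleftrightarrow> (\<forall>i\<in>I. d $ i = 0) \<and> (\<forall>i. d $ i \<le> 0)"
proof -
  have e: "(\<Sum>i\<in>-I. s i *\<^sub>R (- eta i)) $ k = (if k \<in> I then 0 else - s k)" for s and k :: 'a
    by (simp add: eta_def axis_def sum.delta' if_distrib cong: if_cong)
  show ?thesis
  proof
    assume "d \<in> cone I"
    then show "(\<forall>i\<in>I. d $ i = 0) \<and> (\<forall>i. d $ i \<le> 0)"
      unfolding cone_def using e by auto
  next
    assume "(\<forall>i\<in>I. d $ i = 0) \<and> (\<forall>i. d $ i \<le> 0)"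
    then have "d = (\<Sum>i\<in>-I. (- d $ i) *\<^sub>R (- eta i))" "\<forall>i. 0 \<le> - d $ i"
      using e[of "\<lambda>i. - d $ i"] by (auto simp: vec_eq_iff simp del: scaleR_minus_left scaleR_minus_right)
    then show "d \<in> cone I" unfolding cone_def by (intro CollectI exI[of _ "\<lambda>i. - d $ i"]) simp
  qed
qed

lemma restr_pt: "restr I (pt UNIV x) = pt I x"
proof -
  have "(\<exists>x'. (\<exists>c. \<forall>i. x' $ i = x $ i + c) \<and> (\<exists>c. \<forall>i\<in>I. y $ i = x' $ i + c))
      \<longleftrightarrow> (\<exists>c. \<forall>i\<in>I. y $ i = x $ i + c)" (is "?l \<longleftrightarrow> ?r") for y :: "real^'a"
  proof
    assume ?l
    then obtain x' c d where "\<forall>i. x' $ i = x $ i + c" "\<forall>i\<in>I. y $ i = x' $ i + d" by blast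
    then show ?r by (intro exI[of _ "c + d"]) simp
  next
    assume ?r
    then show ?l by (intro exI[of _ x] conjI) (auto intro: exI[of _ 0])
  qed
  then show ?thesis by (simp add: restr_def pt_def)
qed

text \<open>Adding an element of the cone lowers coordinates outside \<open>I\<close>, and the
  restriction maps supply the limit value \<open>0\<close>. So the union over \<open>J\<close>
  merges into one weak inequality. The common factor of homogeneous coordinates is absorbed in
  \<open>u\<close>, because \<open>pt UNIV\<close> ignores constants.\<close>

lemma hpt_in_corner_iff:
  assumes "a \<in> orthant"
  shows "hpt a \<in> corner I U \<longleftrightarrow>
    (\<exists>u. pt UNIV u \<in> U \<and> (\<forall>i\<in>I. a $ i = exp (u $ i)) \<and> (\<forall>j. a $ j \<le> exp (u $ j)))"
proof -
  define J where "J = {i. 0 < a $ i}"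
  have "hpt a \<in> corner I U \<longleftrightarrow> I \<subseteq> J \<and> hpt a \<in> restr J ` add_cone U I"
  \<comment> \<open>The interior part of a corner is the case \<open>J = UNIV\<close> of its
    boundary parts, because \<open>restr UNIV\<close> fixes the points of the apartment.\<close>
  proof (cases "J = UNIV")
    case True
    have "restr UNIV z = z" if "z \<in> add_cone U I" for z
      using that by (auto simp: add_cone_def restr_pt)
    then have "restr UNIV ` add_cone U I = add_cone U I" by simp
    then show ?thesis using True
      by (auto simp: corner_def hpt_def J_def restr_def pt_def)
  next
    case False
    then have "hpt a \<notin> add_cone U I" by (auto simp: add_cone_def hpt_def pt_def J_def)
    have K: "K = J" if "hpt a \<in> restr K ` add_cone U I" for K
      using that by (auto simp: restr_def hpt_def pt_def J_def)
    show ?thesis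
    proof
      assume "hpt a \<in> corner I U"
      then obtain K where "I \<subseteq> K" "hpt a \<in> restr K ` add_cone U I"
        using \<open>hpt a \<notin> add_cone U I\<close> unfolding corner_def by blast
      then show "I \<subseteq> J \<and> hpt a \<in> restr J ` add_cone U I" using K by blast
    next
      assume "I \<subseteq> J \<and> hpt a \<in> restr J ` add_cone U I"
      then show "hpt a \<in> corner I U" using False unfolding corner_def by blast
    qed
  qed
  also have "\<dots> \<longleftrightarrow> I \<subseteq> J \<and> (\<exists>x d. pt UNIV x \<in> U \<and> d \<in> cone I \<and> hpt a = pt J (x + d))"
  proof -
    have "hpt a \<in> restr J ` add_cone U I \<longleftrightarrow> (\<exists>x d. pt UNIV x \<in> U \<and> d \<in> cone I \<and> hpt a = pt J (x + d))"
    proof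
      assume "hpt a \<in> restr J ` add_cone U I"
      then obtain z where z: "z \<in> add_cone U I" "hpt a = restr J z" by blast
      from z(1) obtain x d where "z = pt UNIV (x + d)" "pt UNIV x \<in> U" "d \<in> cone I"
        unfolding add_cone_def by blast
      then show "\<exists>x d. pt UNIV x \<in> U \<and> d \<in> cone I \<and> hpt a = pt J (x + d)"
        using z(2) by (intro exI conjI) (simp_all add: restr_pt)
    next
      assume "\<exists>x d. pt UNIV x \<in> U \<and> d \<in> cone I \<and> hpt a = pt J (x + d)"
      then obtain x d where "pt UNIV x \<in> U" "d \<in> cone I" "hpt a = pt J (x + d)" by blast
      then have "pt UNIV (x + d) \<in> add_cone U I" "hpt a = restr J (pt UNIV (x + d))"
        unfolding add_cone_def by (blast, simp add: restr_pt)
      then show "hpt a \<in> restr J ` add_cone U I" by blast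
    qed
    then show ?thesis by auto
  qed
  also have "\<dots> \<longleftrightarrow> (\<exists>u. pt UNIV u \<in> U \<and> (\<forall>i\<in>I. a $ i = exp (u $ i)) \<and> (\<forall>j. a $ j \<le> exp (u $ j)))"
  proof
    assume "I \<subseteq> J \<and> (\<exists>x d. pt UNIV x \<in> U \<and> d \<in> cone I \<and> hpt a = pt J (x + d))"
    then obtain x d where IJ: "I \<subseteq> J" and x: "pt UNIV x \<in> U" "d \<in> cone I" and
      "hpt a = pt J (x + d)" by blast
    then obtain c where c: "\<And>i. i \<in> J \<Longrightarrow> ln (a $ i) = x $ i + d $ i + c"
      by (auto simp: hpt_def pt_eq_iff J_def)
    have a: "a $ i = exp (x $ i + d $ i + c)" if "i \<in> J" for i
      using c[OF that] that by (metis J_def exp_ln mem_Collect_eq)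
    define u where "u = x + (\<chi> i. c)"
    have "pt UNIV u = pt UNIV x" by (auto simp: pt_eq_iff u_def)
    moreover have "a $ i = exp (u $ i)" if "i \<in> I" for i
      using a[of i] IJ x that by (auto simp: u_def cone_iff)
    moreover have "a $ j \<le> exp (u $ j)" for j
    proof (cases "j \<in> J")
      case True then show ?thesis using a[of j] x by (auto simp: u_def cone_iff)
    next
      case False then show ?thesis by (simp add: J_def not_less) (meson exp_ge_zero order_trans)
    qed
    ultimately show "\<exists>u. pt UNIV u \<in> U \<and> (\<forall>i\<in>I. a $ i = exp (u $ i)) \<and> (\<forall>j. a $ j \<le> exp (u $ j))"
      using x(1) by (intro exI[of _ u]) simp
  next
    assume "\<exists>u. pt UNIV u \<in> U \<and> (\<forall>i\<in>I. a $ i = exp (u $ i)) \<and> (\<forall>j. a $ j \<le> exp (u $ j))"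
    then obtain u where u: "pt UNIV u \<in> U" "\<And>i. i \<in> I \<Longrightarrow> a $ i = exp (u $ i)"
      "\<And>j. a $ j \<le> exp (u $ j)" by blast
    \<comment> \<open>Coordinates outside \<open>J\<close> are invisible in \<open>pt J\<close>, so
      \<open>d\<close> may be \<open>0\<close> there.\<close>
    define d where "d = (\<chi> j. if j \<in> J then ln (a $ j) - u $ j else 0)"
    have "ln (a $ j) \<le> u $ j" if "j \<in> J" for j
      using u(3)[of j] that by (simp add: J_def) (metis exp_gt_zero ln_exp ln_le_cancel_iff)
    then have "d \<in> cone I" using u(2) by (auto simp: d_def cone_iff)
    moreover have "hpt a = pt J (u + d)" by (auto simp: hpt_def pt_eq_iff J_def d_def intro: exI[of _ 0])
    moreover have "I \<subseteq> J" using u(2) by (auto simp: J_def)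
    ultimately show "I \<subseteq> J \<and> (\<exists>x d. pt UNIV x \<in> U \<and> d \<in> cone I \<and> hpt a = pt J (x + d))"
      using u(1) by blast
  qed
  finally show ?thesis .
qed

text \<open>A union of open slices: \<open>W u\<close> keeps the coordinates of \<open>u\<close>
  outside \<open>I\<close> and recovers those in \<open>I\<close> from \<open>a\<close> by the
  logarithm, which is continuous where these coordinates are positive.\<close>

lemma open_exp_region:
  fixes V :: "(real^'n::finite) set"
  assumes "open V"
  shows "open {a. \<exists>u\<in>V. (\<forall>i\<in>I. a $ i = exp (u $ i)) \<and> (\<forall>j\<in>-I. a $ j < exp (u $ j))}" (is "open ?A")
proof -
  define W where "W u = {a :: real^'n. (\<chi> i. if i \<in> I then ln (a $ i) else u $ i) \<in> V \<and>
      (\<forall>i\<in>I. 0 < a $ i) \<and> (\<forall>j\<in>-I. a $ j < exp (u $ j))}" for u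
  have "open (W u)" for u
  proof -
    define P where "P = {a :: real^'n. \<forall>i\<in>I. 0 < a $ i}"
    have P: "open P"
    proof -
      have "P = (\<Inter>i\<in>I. {a. 0 < a $ i})" by (auto simp: P_def)
      then show ?thesis by (auto intro!: open_INT open_Collect_less continuous_intros)
    qed
    have "continuous_on P (\<lambda>a. \<chi> i. if i \<in> I then ln (a $ i) else u $ i)"
      proof (rule continuous_on_vec_lambda)
      fix i show "continuous_on P (\<lambda>a. if i \<in> I then ln (a $ i) else u $ i)"
        by (cases "i \<in> I") (auto simp: P_def intro!: continuous_intros)
    qed
    then have "open ((\<lambda>a. \<chi> i. if i \<in> I then ln (a $ i) else u $ i) -` V \<inter> P)"
      using P assms continuous_on_open_vimage by blast
    moreover have "open (\<Inter>j\<in>-I. {a :: real^'n. a $ j < exp (u $ j)})"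
      by (auto intro!: open_INT open_Collect_less continuous_intros)
    moreover have "W u = ((\<lambda>a. \<chi> i. if i \<in> I then ln (a $ i) else u $ i) -` V \<inter> P)
        \<inter> (\<Inter>j\<in>-I. {a. a $ j < exp (u $ j)})"
      by (auto simp: W_def P_def)
    ultimately show ?thesis by (simp only: open_Int)
  qed
  moreover have "?A = (\<Union>u. W u)"
  proof
    show "?A \<subseteq> (\<Union>u. W u)"
    proof
      fix a assume "a \<in> ?A"
      then obtain u where u: "u \<in> V" "\<forall>i\<in>I. a $ i = exp (u $ i)" "\<forall>j\<in>-I. a $ j < exp (u $ j)" by blast
      then have "(\<chi> i. if i \<in> I then ln (a $ i) else u $ i) = u" by (simp add: vec_eq_iff)
      then have "a \<in> W u" using u by (simp add: W_def)
      then show "a \<in> (\<Union>u. W u)" by blast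
    qed
    show "(\<Union>u. W u) \<subseteq> ?A"
    proof
      fix a assume "a \<in> (\<Union>u. W u)"
      then obtain u where "a \<in> W u" by blast
      then show "a \<in> ?A" by (auto simp: W_def intro!: bexI[of _ "\<chi> i. if i \<in> I then ln (a $ i) else u $ i"])
    qed
  qed
  ultimately show ?thesis by auto
qed

text \<open>As the set of admissible \<open>u\<close> is open, \<open>u\<close> can be raised a
  little outside \<open>I\<close>. This makes the weak inequalities of the corner strict, hence open
  in \<open>a\<close>.\<close>

lemma openin_hpt_vimage_corner:
  assumes "open_in_apartment U"
  shows "openin (top_of_set orthant) {a \<in> orthant. hpt a \<in> corner I U}"
proof -
  define V where "V = {x. pt UNIV x \<in> U}"
  have V: "open V" using assms by (simp add: V_def open_in_apartment_def)
  have "{a \<in> orthant. hpt a \<in> corner I U} = orthant \<inter>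
    {a. \<exists>u\<in>V. (\<forall>i\<in>I. a $ i = exp (u $ i)) \<and> (\<forall>j\<in>-I. a $ j < exp (u $ j))}" (is "?L = orthant \<inter> ?R")
  proof
    show "?L \<subseteq> orthant \<inter> ?R"
    proof
      fix a assume "a \<in> ?L"
      then obtain u where a: "a \<in> orthant" and u: "u \<in> V" "\<And>i. i \<in> I \<Longrightarrow> a $ i = exp (u $ i)"
        "\<And>j. a $ j \<le> exp (u $ j)" by (auto simp: hpt_in_corner_iff V_def)
      obtain e where e: "e > 0" "ball u e \<subseteq> V" using V u(1) open_contains_ball by blast
      define d :: "real^'a" where "d = (\<chi> i. if i \<in> I then 0 else 1)"
      \<comment> \<open>The denominator stays positive also for \<open>I = UNIV\<close>, where
        \<open>d = 0\<close>.\<close>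
      define s where "s = e / (2 * (norm d + 1))"
      have s: "s > 0" using e unfolding s_def by (intro divide_pos_pos mult_pos_pos add_nonneg_pos) auto
      have "norm (s *\<^sub>R d) < e"
      proof -
        have "s * norm d \<le> s * (norm d + 1)" using s by simp
        also have "\<dots> = e / 2" using add_nonneg_pos[OF norm_ge_zero zero_less_one, of d] by (simp add: s_def divide_simps)
        also have "\<dots> < e" using e by simp
        finally show ?thesis using s by simp
      qed
      then have "u + s *\<^sub>R d \<in> V" using e(2) by (auto simp: dist_norm)
      moreover have "a $ i = exp ((u + s *\<^sub>R d) $ i)" if "i \<in> I" for i
        using u(2) that by (simp add: d_def)
      moreover have "a $ j < exp ((u + s *\<^sub>R d) $ j)" if "j \<in> -I" for j
      proof -
        have "exp (u $ j) < exp ((u + s *\<^sub>R d) $ j)" using that s by (simp add: d_def)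
        then show ?thesis using u(3)[of j] by linarith
      qed
      ultimately show "a \<in> orthant \<inter> ?R" using a by blast
    qed
    show "orthant \<inter> ?R \<subseteq> ?L"
    proof
      fix a assume a: "a \<in> orthant \<inter> ?R"
      then obtain u where u: "u \<in> V" "\<forall>i\<in>I. a $ i = exp (u $ i)" "\<forall>j\<in>-I. a $ j < exp (u $ j)" by blast
      then have "\<forall>j. a $ j \<le> exp (u $ j)" by (metis ComplI less_imp_le order_refl)
      then show "a \<in> ?L" using a u by (auto simp: hpt_in_corner_iff V_def)
    qed
  qed
  then show ?thesis using open_exp_region[OF V] by (simp add: openin_open_Int)
qed

text \<open>For \<open>I = UNIV\<close> the cone is \<open>0\<close>, so the open subsets of the
  apartment are themselves corners and both kinds of generating sets can be treated alike.\<close>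

lemma corner_UNIV: "U \<subseteq> apartment \<Longrightarrow> corner UNIV U = U"
proof -
  assume U: "U \<subseteq> apartment"
  have "d \<in> cone UNIV \<longleftrightarrow> d = 0" for d :: "real^'a" by (auto simp: cone_iff vec_eq_iff)
  then have "add_cone U UNIV = {pt UNIV x | x. pt UNIV x \<in> U}" by (simp add: add_cone_def)
  also have "\<dots> = U" using U unfolding piece_def by blast
  finally show ?thesis by (auto simp: corner_def)
qed

lemma corner_subset: 
  assumes "I \<noteq> {}" shows "corner I U \<subseteq> cpt_apartment"
proof -
  have pt: "pt J x \<in> cpt_apartment" if "I \<subseteq> J" for J x
    using that assms by (intro pt_in_cpt_apartment) blast
  have "add_cone U I \<subseteq> cpt_apartment" "\<And>J. I \<subseteq> J \<Longrightarrow> restr J ` add_cone U I \<subseteq> cpt_apartment"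
    using pt by (auto simp: add_cone_def restr_pt)
  then show ?thesis unfolding corner_def by blast
qed

lemma openin_corner:
  assumes "open_in_apartment U" "bounded_in_apartment U" "I \<noteq> {}"
  shows "openin cpt_apartment_topology (corner I U)"
proof (cases "I = UNIV")
  case True
  then have "corner I U = U" using assms by (simp add: corner_UNIV open_in_apartment_def)
  moreover have "openin cpt_apartment_topology U" unfolding cpt_apartment_topology_def
    by (rule topology_generated_by_Basis, rule UnI1) (simp add: assms)
  ultimately show ?thesis by simp
next
  case False
  then have "I \<subset> UNIV" by blast
  then have "corner I U \<in> {corner I U | I U. I \<noteq> {} \<and> I \<subset> UNIV \<and> open_in_apartment U \<and> bounded_in_apartment U}"
    using assms by (intro CollectI exI conjI) (rule refl)
  then show ?thesis unfolding cpt_apartment_topology_def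
    by (rule topology_generated_by_Basis[OF UnI2])
qed

text \<open>The key to openness of \<open>hpt\<close>. A corner determines coordinates only up to a
  factor, so a point of it is compared with \<open>a\<close> through an unnormalized representative;
  continuity of the normalization at \<open>a\<close> then supplies the admissible distance
  \<open>e\<close>.\<close>

lemma ex_corner_nbhd:
  assumes a: "a \<in> cube_face" and S: "open S" "a \<in> S"
  obtains I U where "open_in_apartment U" "bounded_in_apartment U" "I \<noteq> {}"
    "hpt a \<in> corner I U" "\<And>b. b \<in> cube_face \<Longrightarrow> hpt b \<in> corner I U \<Longrightarrow> b \<in> S"
proof -
  define I where "I = {i. 0 < a $ i}"
  have a0: "a \<in> orthant" using a by (rule cube_face_orthant)
  have I: "I \<noteq> {}" using orthant_pos[OF a0] by (simp add: I_def)
  have "infnorm a = 1" using a by (simp add: cube_face_def)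
  have cont: "((\<lambda>b. b /\<^sub>R infnorm b) \<longlongrightarrow> a /\<^sub>R infnorm a) (at a)"
    using \<open>infnorm a = 1\<close>
    by (intro tendsto_scaleR tendsto_inverse tendsto_infnorm tendsto_ident_at) simp
  have "eventually (\<lambda>b. b /\<^sub>R infnorm b \<in> S) (at a)"
    using topological_tendstoD[OF cont S(1)] S(2) \<open>infnorm a = 1\<close> by simp
  then obtain e where e: "e > 0" "\<And>b. dist b a < e \<Longrightarrow> b \<noteq> a \<Longrightarrow> b /\<^sub>R infnorm b \<in> S"
    unfolding eventually_at by auto
  have e': "b /\<^sub>R infnorm b \<in> S" if "dist b a < e" for b
    using e(2)[OF that] S(2) \<open>infnorm a = 1\<close> by (cases "b = a") auto
  \<comment> \<open>Half of the minimum: \<open>d\<close> is strictly below every positive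
    coordinate of \<open>a\<close>, so that \<open>ln (a $ i - d)\<close> makes sense, and
    \<open>CARD('a) * d < e\<close>, so that a coordinatewise error \<open>d\<close> gives distance
    below \<open>e\<close> by the \<open>l1\<close> bound.\<close>
  define d where "d = Min (insert (e / (real CARD('a) + 1)) ((\<lambda>i. a $ i) ` I)) / 2"
  have d0: "d > 0" using e by (auto simp: d_def I_def)
  have "2 * d \<le> e / (real CARD('a) + 1)" unfolding d_def by simp
  then have "2 * d * (real CARD('a) + 1) \<le> e" by (subst (asm) pos_le_divide_eq) auto
  moreover have "real CARD('a) * d < 2 * d * (real CARD('a) + 1)"
    using d0 by (simp add: algebra_simps add_strict_increasing)
  ultimately have de: "real CARD('a) * d < e" by linarith
  have da: "d < a $ i" if "i \<in> I" for i
  proof -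
    have "2 * d \<le> a $ i" unfolding d_def using that by simp
    then show ?thesis using d0 by linarith
  qed
  \<comment> \<open>Outside \<open>I\<close> only the upper end matters, since corners are closed
    under lowering these coordinates; the lower end \<open>ln (d / 2)\<close> keeps the box bounded
    and nonempty.\<close>
  define l where "l = (\<chi> i. if i \<in> I then ln (a $ i - d) else ln (d / 2))"
  define r where "r = (\<chi> i. if i \<in> I then ln (a $ i + d) else ln d)"
  define B where "B = box l r"
  define U :: "'a apt_point set" where "U = pt UNIV ` B"
  \<comment> \<open>Openness in the quotient is tested on the preimage, the union of all translates
    of the box along the diagonal line.\<close>
  have shift: "{x. pt UNIV x \<in> U} = (\<Union>c. (\<lambda>x. x + (\<chi> i. c)) ` B)"
  proof (rule subset_antisym; rule subsetI)
    fix x assume "x \<in> {x. pt UNIV x \<in> U}"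
    then obtain y c where y: "y \<in> B" "\<forall>i. x $ i = y $ i + c" by (auto simp: U_def pt_eq_iff)
    then have "x = y + (\<chi> i. c)" by (simp add: vec_eq_iff)
    then show "x \<in> (\<Union>c. (\<lambda>x. x + (\<chi> i. c)) ` B)" using y by blast
  next
    fix x assume "x \<in> (\<Union>c. (\<lambda>x. x + (\<chi> i. c)) ` B)"
    then obtain y c where "y \<in> B" "x = y + (\<chi> i. c)" by blast
    then have "pt UNIV x = pt UNIV y" "y \<in> B" by (auto simp: pt_eq_iff)
    then show "x \<in> {x. pt UNIV x \<in> U}" by (auto simp: U_def)
  qed
  have "open ((\<lambda>x. x + (\<chi> i. c)) ` B)" for c :: real
    using open_translation[of B "\<chi> i. c"] by (simp add: B_def add.commute open_box)
  then have "open {x. pt UNIV x \<in> U}" unfolding shift by blast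
  then have "open_in_apartment U"
    unfolding open_in_apartment_def U_def piece_def by blast
  moreover have "bounded_in_apartment U"
    unfolding bounded_in_apartment_def U_def using bounded_box[of l r] B_def by blast
  moreover have "hpt a \<in> corner I U"
  proof -
    define u where "u = (\<chi> i. if i \<in> I then ln (a $ i) else ln (3 * d / 4))"
    have "u \<in> B" using d0 da by (auto simp: B_def mem_box_cart u_def l_def r_def I_def)
    moreover have "\<forall>i\<in>I. a $ i = exp (u $ i)" by (simp add: u_def I_def)
    moreover have "\<forall>j. a $ j \<le> exp (u $ j)"
    proof
      fix j show "a $ j \<le> exp (u $ j)"
      proof (cases "j \<in> I")
        case True then show ?thesis by (simp add: u_def I_def)
      next
        case False
        then have "a $ j = 0" using a0 by (auto simp: I_def orthant_def not_less order_antisym)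
        then show ?thesis by simp
      qed
    qed
    ultimately show ?thesis using a0 by (auto simp: hpt_in_corner_iff U_def)
  qed
  moreover have "b \<in> S" if b: "b \<in> cube_face" and hb: "hpt b \<in> corner I U" for b
  proof -
    obtain u where u: "pt UNIV u \<in> U" "\<And>i. i \<in> I \<Longrightarrow> b $ i = exp (u $ i)" "\<And>j. b $ j \<le> exp (u $ j)"
      using iffD1[OF hpt_in_corner_iff[OF cube_face_orthant[OF b]] hb] by blast
    from u(1) obtain y where "y \<in> B" "pt UNIV u = pt UNIV y" unfolding U_def by blast
    then obtain c where y: "y \<in> B" "\<And>i. u $ i = y $ i + c" unfolding pt_eq_iff by blast
    \<comment> \<open>Removing the common constant \<open>c\<close> yields the representative of
      \<open>hpt b\<close> close to \<open>a\<close>; its normalization is \<open>b\<close>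
      again.\<close>
    define b' where "b' = exp (- c) *\<^sub>R b"
    have "\<bar>(b' - a) $ i\<bar> \<le> d" for i
    proof (cases "i \<in> I")
      case True
      have "b' $ i = exp (y $ i)" using u(2)[OF True] y(2) by (simp add: b'_def mult_exp_exp)
      moreover have "ln (a $ i - d) < y $ i" "y $ i < ln (a $ i + d)"
        using y(1) True by (auto simp: B_def mem_box_cart l_def r_def dest!: spec[of _ i])
      moreover have "exp (ln (a $ i - d)) = a $ i - d" "exp (ln (a $ i + d)) = a $ i + d"
        using da[OF True] d0 by simp_all
      ultimately have "a $ i - d < b' $ i" "b' $ i < a $ i + d" by (metis exp_less_mono)+
      then show ?thesis by (simp add: abs_if)
    next
      case False
      then have "a $ i = 0" using a0 by (auto simp: I_def orthant_def not_less order_antisym)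
      have "y $ i < ln d"
        using y(1) False by (auto simp: B_def mem_box_cart l_def r_def dest!: spec[of _ i])
      then have "exp (y $ i) < d" using d0 by (metis exp_less_mono exp_ln)
      moreover have "b' $ i \<le> exp (y $ i)"
      proof -
        have "exp (- c) * b $ i \<le> exp (- c) * exp (u $ i)" using u(3) by simp
        then show ?thesis by (simp add: b'_def mult_exp_exp y(2))
      qed
      moreover have "0 \<le> b' $ i" using b by (simp add: b'_def cube_face_def)
      ultimately show ?thesis using \<open>a $ i = 0\<close> by simp
    qed
    then have "(\<Sum>i\<in>UNIV. \<bar>(b' - a) $ i\<bar>) \<le> real CARD('a) * d"
      using sum_bounded_above[of UNIV "\<lambda>i. \<bar>(b' - a) $ i\<bar>" d] by simp
    then have "dist b' a < e" using norm_le_l1_cart[of "b' - a"] de by (simp add: dist_norm)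
    then have "b' /\<^sub>R infnorm b' \<in> S" by (rule e')
    moreover have "b' /\<^sub>R infnorm b' = b" using b by (simp add: b'_def infnorm_mul cube_face_def)
    ultimately show ?thesis by simp
  qed
  ultimately show ?thesis using that I by blast
qed

lemma topspace_cpt_apartment [simp]: "topspace cpt_apartment_topology = cpt_apartment"
proof
  have "U \<subseteq> cpt_apartment" if "open_in_apartment U" for U :: "'a apt_point set"
    using that by (auto simp: open_in_apartment_def cpt_apartment_def)
  then show "topspace (cpt_apartment_topology :: 'a apt_point topology) \<subseteq> cpt_apartment"
    using corner_subset unfolding cpt_apartment_topology_def topology_generated_by_topspace by blast
  show "cpt_apartment \<subseteq> topspace (cpt_apartment_topology :: 'a apt_point topology)"
  proof
    fix z :: "'a apt_point" assume "z \<in> cpt_apartment"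
    then obtain a where a: "a \<in> cube_face" "z = hpt a" using hpt_cube_face by blast
    obtain I U where "openin cpt_apartment_topology (corner I U)" "hpt a \<in> corner I U"
      using ex_corner_nbhd[OF a(1) open_UNIV] openin_corner by (metis UNIV_I)
    then show "z \<in> topspace cpt_apartment_topology" using a openin_subset by blast
  qed
qed

text \<open>Transfers the topology given by generators to a subset of a Euclidean space; closures
  and continuity in the compactified apartment are computed there.\<close>

proposition homeomorphic_map_hpt:
  "homeomorphic_map (top_of_set cube_face) cpt_apartment_topology hpt"
proof (rule bijective_open_imp_homeomorphic_map)
  have cf: "cube_face \<subseteq> (orthant :: (real^'a) set)" using cube_face_orthant by blast
  show "continuous_map (top_of_set cube_face) (cpt_apartment_topology :: 'a apt_point topology) hpt"
    unfolding cpt_apartment_topology_def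
  proof (rule continuous_on_generated_topo)
    have *: "openin (top_of_set cube_face) (hpt -` corner I U \<inter> cube_face)"
      if U: "open_in_apartment U" for I and U :: "'a apt_point set"
    proof -
      have "hpt -` corner I U \<inter> cube_face = cube_face \<inter> {a \<in> orthant. hpt a \<in> corner I U}"
        using cf by blast
      moreover obtain T where "open T" "{a \<in> orthant. hpt a \<in> corner I U} = orthant \<inter> T"
        using openin_hpt_vimage_corner[OF U, of I] unfolding openin_open by blast
      moreover have "cube_face \<inter> (orthant \<inter> T) = cube_face \<inter> T" using cf by blast
      ultimately show ?thesis by (metis openin_open_Int)
    qed
    fix U :: "'a apt_point set"
    assume "U \<in> {U. open_in_apartment U} \<union> {corner I U | I U. I \<noteq> {} \<and> I \<subset> UNIV \<and> open_in_apartment U \<and> bounded_in_apartment U}"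
    then consider "open_in_apartment U" | I U' where "U = corner I U'" "open_in_apartment U'" by blast
    then show "openin (top_of_set cube_face) (hpt -` U \<inter> topspace (top_of_set cube_face))"
    proof cases
      case 1
      then show ?thesis using *[OF 1, of UNIV] corner_UNIV[of U] by (simp add: open_in_apartment_def)
    next
      case 2
      then show ?thesis using * by simp
    qed
  next
    show "hpt ` topspace (top_of_set cube_face) \<subseteq>
       \<Union> ({U. open_in_apartment U} \<union> {corner I U | I U. I \<noteq> {} \<and> I \<subset> UNIV \<and> open_in_apartment U \<and> bounded_in_apartment (U :: 'a apt_point set)})"
      using topspace_cpt_apartment[where 'a = 'a]
      unfolding cpt_apartment_topology_def topology_generated_by_topspace by (simp only: topspace_euclidean_subtopology hpt_cube_face)
  qed
  show "open_map (top_of_set cube_face) (cpt_apartment_topology :: 'a apt_point topology) hpt"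
    unfolding open_map_def
  proof (intro allI impI)
    fix W :: "(real^'a) set" assume "openin (top_of_set cube_face) W"
    then obtain S where S: "open S" "W = cube_face \<inter> S" by (auto simp: openin_open)
    show "openin cpt_apartment_topology (hpt ` W)"
    proof (subst openin_subopen, intro ballI)
      fix z assume "z \<in> hpt ` W"
      then obtain a where a: "a \<in> cube_face" "a \<in> S" "z = hpt a" using S by blast
      obtain I U where U: "open_in_apartment U" "bounded_in_apartment U" "I \<noteq> {}"
        "hpt a \<in> corner I U" "\<And>b. b \<in> cube_face \<Longrightarrow> hpt b \<in> corner I U \<Longrightarrow> b \<in> S"
        using ex_corner_nbhd[OF a(1) S(1) a(2)] by metis
      have "corner I U \<subseteq> hpt ` W"
      proof
        fix y assume "y \<in> corner I U"
        moreover obtain b where "b \<in> cube_face" "y = hpt b"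
          using calculation corner_subset[OF U(3)] hpt_cube_face by blast
        ultimately show "y \<in> hpt ` W" using U(5) S(2) by blast
      qed
      then show "\<exists>T. openin cpt_apartment_topology T \<and> z \<in> T \<and> T \<subseteq> hpt ` W"
        using openin_corner[OF U(1-3)] U(4) a(3) by blast
    qed
  qed
qed (auto simp: hpt_cube_face inj_on_hpt)

section \<open>Half apartments and root functions\<close>

lemma half_apartment_eq:
  "half_apartment i j t =
    hpt ` {b \<in> cube_face. (\<forall>k. 0 < b $ k) \<and> b $ j \<le> exp t * b $ i}" (is "_ = hpt ` ?S")
proof
  show "half_apartment i j t \<subseteq> hpt ` ?S"
  proof
    fix z assume "z \<in> half_apartment i j t"
    then obtain x where x: "z = pt UNIV x" "x $ i - x $ j \<ge> - t" unfolding half_apartment_def by blast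
    define b where "b = (\<chi> k. exp (x $ k))"
    have "exp (x $ j) \<le> exp (t + x $ i)" using x(2) by simp
    then have "b $ j \<le> exp t * b $ i" by (simp add: b_def exp_add)
    have "b $ i \<noteq> 0" by (simp add: b_def)
    then have "b \<noteq> 0" by auto
    then have b: "b \<in> orthant" "infnorm b > 0" by (simp_all add: orthant_def b_def infnorm_pos_lt)
    have "z = hpt (b /\<^sub>R infnorm b)" using b by (simp add: x pt_eq_hpt b_def hpt_scale)
    moreover have "b /\<^sub>R infnorm b \<in> ?S"
    proof -
      have "b $ j * inverse (infnorm b) \<le> exp t * b $ i * inverse (infnorm b)"
        using b \<open>b $ j \<le> exp t * b $ i\<close> by (intro mult_right_mono) auto
      then show ?thesis using infnorm_normalize[OF b(1)] b(2) by (simp add: b_def mult_ac)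
    qed
    ultimately show "z \<in> hpt ` ?S" by (rule image_eqI)
  qed
  show "hpt ` ?S \<subseteq> half_apartment i j t"
  proof
    fix z assume "z \<in> hpt ` ?S"
    then obtain b where b: "z = hpt b" "\<And>k. 0 < b $ k" "b $ j \<le> exp t * b $ i" by blast
    have "exp (ln (b $ j)) \<le> exp (t + ln (b $ i))" using b(2,3) by (simp add: exp_add)
    then have "(\<chi> k. ln (b $ k)) $ i - (\<chi> k. ln (b $ k)) $ j \<ge> - t" by simp
    moreover have "z = pt UNIV (\<chi> k. ln (b $ k))" using b(2) by (simp add: b(1) hpt_def)
    ultimately show "z \<in> half_apartment i j t" unfolding half_apartment_def by blast
  qed
qed

text \<open>The inequality is closed, so it passes to limits. Conversely, a point satisfying it is
  approximated by raising its coordinates to small positive values in a way that preserves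
  it.\<close>

lemma closure_half_apartment_iff:
  assumes a: "a \<in> cube_face" and ij: "i \<noteq> j"
  shows "hpt a \<in> cpt_apartment_topology closure_of half_apartment i j t \<longleftrightarrow> a $ j \<le> exp t * a $ i"
proof -
  define S where "S = {b \<in> cube_face. (\<forall>k. 0 < b $ k) \<and> b $ j \<le> exp t * b $ i}"
  have S: "S \<subseteq> cube_face" by (auto simp: S_def)
  have "cpt_apartment_topology closure_of half_apartment i j t
      = hpt ` (top_of_set cube_face closure_of S)"
    unfolding half_apartment_eq S_def[symmetric]
    using homeomorphic_map_closure_of[OF homeomorphic_map_hpt] S by simp
  also have "top_of_set cube_face closure_of S = cube_face \<inter> closure S"
    using S by (simp add: closure_of_subtopology inf.absorb2)
  finally have "hpt a \<in> cpt_apartment_topology closure_of half_apartment i j t \<longleftrightarrow> a \<in> closure S"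
    using a inj_on_image_mem_iff[OF inj_on_hpt a, of "cube_face \<inter> closure S"] by simp
  also have "\<dots> \<longleftrightarrow> a $ j \<le> exp t * a $ i"
  proof
    assume "a \<in> closure S"
    moreover have "closed {b :: real^'a. b $ j \<le> exp t * b $ i}"
      by (intro closed_Collect_le continuous_intros)
    moreover have "S \<subseteq> {b. b $ j \<le> exp t * b $ i}" by (auto simp: S_def)
    ultimately show "a $ j \<le> exp t * a $ i" using closure_minimal by blast
  next
    assume le: "a $ j \<le> exp t * a $ i"
    show "a \<in> closure S"
      unfolding closure_approachable
    proof (intro allI impI)
      fix e :: real assume "e > 0"
      define s where "s = min (1/2) (e / (real CARD('a) + 1))"
      \<comment> \<open>For \<open>exp t < 1\<close> a common level \<open>s\<close> could violate
        the inequality, so coordinate \<open>j\<close> is only raised to \<open>s * m\<close> with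
        \<open>m \<le> exp t\<close>. The bound \<open>m \<le> 1\<close> keeps this change at most
        \<open>s\<close>.\<close>
      define m where "m = min 1 (exp t)"
      have s: "0 < s" "s < 1" using \<open>e > 0\<close> by (auto simp: s_def)
      have m: "0 < m" "m \<le> 1" "m \<le> exp t" by (auto simp: m_def)
      have sm: "0 < s * m" "s * m \<le> s" using s m by auto
      define b where "b = (\<chi> k. max (a $ k) (if k = j then s * m else s))"
      have "b \<in> cube_face"
      proof -
        obtain k where "a $ k = 1" using a by (auto simp: cube_face_iff)
        then have "b $ k = 1" using s sm by (auto simp: b_def)
        moreover have "0 \<le> b $ k \<and> b $ k \<le> 1" for k
          using a s sm by (auto simp: b_def cube_face_iff max_def)
        ultimately show ?thesis unfolding cube_face_iff by blast
      qed
      moreover have "0 < b $ k" for k using s sm by (auto simp: b_def less_max_iff_disj)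
      moreover have "b $ j \<le> exp t * b $ i"
      proof -
        have "a $ j \<le> exp t * max (a $ i) s"
        proof -
          have "exp t * a $ i \<le> exp t * max (a $ i) s" by (intro mult_left_mono) auto
          then show ?thesis using le by linarith
        qed
        moreover have "s * m \<le> exp t * max (a $ i) s"
        proof -
          have "m * s \<le> exp t * max (a $ i) s" using s m by (intro mult_mono) auto
          then show ?thesis by (simp add: mult.commute)
        qed
        ultimately show ?thesis using ij by (simp add: b_def)
      qed
      ultimately have "b \<in> S" by (simp add: S_def)
      have "\<bar>(b - a) $ k\<bar> \<le> s" for k
      proof -
        have "0 \<le> a $ k" using a by (simp add: cube_face_iff)
        then show ?thesis using s sm by (auto simp: b_def max_def)
      qed
      then have "(\<Sum>k\<in>UNIV. \<bar>(b - a) $ k\<bar>) \<le> real CARD('a) * s"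
        using sum_bounded_above[of UNIV "\<lambda>k. \<bar>(b - a) $ k\<bar>" s] by simp
      also have "\<dots> < (real CARD('a) + 1) * s" using s by simp
      also have "\<dots> \<le> (real CARD('a) + 1) * (e / (real CARD('a) + 1))"
        by (intro mult_left_mono) (simp_all add: s_def)
      also have "\<dots> = e" by (simp add: add_nonneg_eq_0_iff)
      finally have "dist b a < e" using norm_le_l1_cart[of "b - a"] by (simp add: dist_norm)
      then show "\<exists>y\<in>S. dist y a < e" using \<open>b \<in> S\<close> by blast
    qed
  qed
  finally show ?thesis .
qed

lemma root_fun_hpt_le_iff:
  assumes a: "a \<in> orthant" and ij: "i \<noteq> j"
  shows "root_fun (hpt a) i j \<le> ereal r \<longleftrightarrow> a $ j \<le> exp r * a $ i"
proof -
  have pos: "infnorm a > 0" using a by (simp add: orthant_def infnorm_pos_lt)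
  define T where "T = {t. a $ j \<le> exp t * a $ i}"
  have "hpt a = hpt (a /\<^sub>R infnorm a)" using pos by (simp add: hpt_scale)
  then have "{t. hpt a \<in> cpt_apartment_topology closure_of half_apartment i j t} = T"
    using closure_half_apartment_iff[OF infnorm_normalize[OF a] ij] pos
    by (simp add: T_def field_simps)
  then have R: "root_fun (hpt a) i j = Inf (ereal ` T)" by (simp add: root_fun_def)
  show ?thesis
  proof
    assume "a $ j \<le> exp r * a $ i"
    then show "root_fun (hpt a) i j \<le> ereal r" unfolding R T_def by (intro Inf_lower) blast
  next
    assume le: "root_fun (hpt a) i j \<le> ereal r"
    show "a $ j \<le> exp r * a $ i"
    proof (rule ccontr)
      assume *: "\<not> a $ j \<le> exp r * a $ i"
      have "0 \<le> a $ i" using a by (simp add: orthant_def)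
      then have j: "0 < a $ j" using * by (meson exp_ge_zero linorder_not_le mult_nonneg_nonneg order_le_less_trans)
      show False
      proof (cases "a $ i = 0")
        case True
        \<comment> \<open>A point with \<open>a $ i = 0 < a $ j\<close> lies in the closure of no
          half apartment for this root, and \<open>Inf {}\<close> is infinite in
          \<open>ereal\<close>.\<close>
        then have "T = {}" using j by (auto simp: T_def)
        then show False using le R by (simp add: top_ereal_def)
      next
        case False
        then have i: "0 < a $ i" using \<open>0 \<le> a $ i\<close> by simp
        have "ln (a $ j / a $ i) \<le> t" if "t \<in> T" for t
        proof -
          have "a $ j / a $ i \<le> exp t" using that i by (simp add: T_def field_simps)
          then show ?thesis using i j by (metis divide_pos_pos exp_le_cancel_iff exp_ln)
        qed
        then have "ereal (ln (a $ j / a $ i)) \<le> Inf (ereal ` T)"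
          by (intro Inf_greatest) auto
        moreover have "r < ln (a $ j / a $ i)"
        proof -
          have "exp r < a $ j / a $ i" using * i by (simp add: field_simps)
          then show ?thesis using i j by (metis divide_pos_pos exp_less_cancel_iff exp_ln)
        qed
        ultimately show False using le R by (metis ereal_less_eq(3) linorder_not_le order_trans)
      qed
    qed
  qed
qed

section \<open>Matrices and the projective linear group\<close>

definition mono_mat :: "('n \<Rightarrow> 'k::field) \<Rightarrow> ('n \<Rightarrow> 'n) \<Rightarrow> 'k^'n^'n::finite" where
  "mono_mat t w = diag_mat t ** perm_mat w"

lemma mono_mat_nth [simp]: "mono_mat t w $ i $ j = (if i = w j then t i else 0)"
proof -
  have "mono_mat t w $ i $ j = (\<Sum>k\<in>UNIV. (if i = k then t i else 0) * (if k = w j then 1 else 0))"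
    by (simp add: mono_mat_def matrix_matrix_mult_def diag_mat_def perm_mat_def)
  also have "\<dots> = (\<Sum>k\<in>UNIV. if k = i then (if i = w j then t i else 0) else 0)"
    by (intro sum.cong refl) auto
  finally show ?thesis by simp
qed

lemma mono_mat_mult:
  assumes "bij w"
  shows "mono_mat t w ** mono_mat s u = mono_mat (\<lambda>l. t l * s (inv_into UNIV w l)) (w \<circ> u)"
proof -
  have "(mono_mat t w ** mono_mat s u) $ i $ j = mono_mat (\<lambda>l. t l * s (inv_into UNIV w l)) (w \<circ> u) $ i $ j" for i j
  proof -
    have "(mono_mat t w ** mono_mat s u) $ i $ j = (\<Sum>k\<in>UNIV. if k = u j then (if i = w k then t i * s k else 0) else 0)"
      unfolding matrix_matrix_mult_def vec_lambda_beta by (intro sum.cong refl) simp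
    then show ?thesis using assms by (auto simp: bij_is_inj)
  qed
  then show ?thesis by (simp add: vec_eq_iff)
qed

lemma mono_mat_1: "mono_mat (\<lambda>_. 1) id = mat 1"
  by (simp add: vec_eq_iff mat_def)

lemma mono_mat_inverse:
  assumes "bij w" "\<And>i. t i \<noteq> 0"
  shows "mono_mat t w ** mono_mat (\<lambda>l. inverse (t (w l))) (inv_into UNIV w) = mat 1"
    and "mono_mat (\<lambda>l. inverse (t (w l))) (inv_into UNIV w) ** mono_mat t w = mat 1"
  using assms
  by (simp_all add: mono_mat_mult bij_imp_bij_inv inv_inv_eq mono_mat_1 bij_is_surj surj_f_inv_f
      surj_iff[THEN iffD1] inj_iff[THEN iffD1] bij_is_inj)

lemma mat_mult_nth [simp]: "(mat c ** A) $ i $ j = c * (A $ i $ j)"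
proof -
  have "(mat c ** A) $ i $ j = (\<Sum>k\<in>UNIV. if k = i then c * (A $ k $ j) else 0)"
    unfolding matrix_matrix_mult_def mat_def vec_lambda_beta by (intro sum.cong refl) simp
  then show ?thesis by simp
qed

lemma mult_mat_nth [simp]: "(A ** mat c) $ i $ j = (A $ i $ j) * c"
proof -
  have "(A ** mat c) $ i $ j = (\<Sum>k\<in>UNIV. if k = j then (A $ i $ k) * c else 0)"
    unfolding matrix_matrix_mult_def mat_def vec_lambda_beta by (intro sum.cong refl) simp
  then show ?thesis by simp
qed

lemma mat_mult_commute: "mat c ** A = A ** mat (c :: 'k::comm_ring_1)"
  by (simp add: vec_eq_iff mult.commute)

lemma mat_mult_mat: "mat c ** mat d = mat (c * d :: 'k::comm_ring_1)"
  by (simp add: vec_eq_iff) (simp add: mat_def)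

lemma invertible_mat: "c \<noteq> 0 \<Longrightarrow> invertible (mat (c :: 'k::field))"
  unfolding invertible_def by (intro exI[of _ "mat (inverse c)"]) (simp add: mat_mult_mat)

lemma group_GL: "group (GL :: ('k::field^'n::finite^'n) monoid)"
proof (rule groupI)
  fix A :: "'k^'n^'n" assume "A \<in> carrier GL"
  then obtain B where "A ** B = mat 1" "B ** A = mat 1" by (auto simp: GL_def invertible_def)
  then show "\<exists>B\<in>carrier GL. B \<otimes>\<^bsub>GL\<^esub> A = \<one>\<^bsub>GL\<^esub>"
    by (auto simp: GL_def invertible_def)
qed (auto simp: GL_def invertible_mult invertible_mat matrix_mul_assoc)

lemma normal_scalars: "normal scalars (GL :: ('k::field^'n::finite^'n) monoid)"
proof -
  interpret group "GL :: ('k^'n^'n) monoid" by (rule group_GL)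
  have "subgroup scalars (GL :: ('k^'n^'n) monoid)"
  proof (rule subgroupI)
    show "scalars \<subseteq> carrier (GL :: ('k^'n^'n) monoid)"
      by (auto simp: scalars_def GL_def invertible_mat)
    show "scalars \<noteq> ({} :: ('k^'n^'n) set)"
      by (auto simp: scalars_def intro: exI[of _ 1])
    fix A B :: "'k^'n^'n" assume A: "A \<in> scalars"
    then obtain c where c: "A = mat c" "c \<noteq> 0" by (auto simp: scalars_def)
    have "inv\<^bsub>GL\<^esub> A = mat (inverse c)"
      using c by (intro inv_equality) (auto simp: GL_def invertible_mat mat_mult_mat)
    then show "inv\<^bsub>GL\<^esub> A \<in> scalars" using c by (auto simp: scalars_def)
    assume "B \<in> scalars"
    then obtain d where d: "B = mat d" "d \<noteq> 0" by (auto simp: scalars_def)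
    show "A \<otimes>\<^bsub>GL\<^esub> B \<in> scalars" using c d by (auto simp: scalars_def GL_def mat_mult_mat)
  qed
  then show ?thesis
  proof (rule normalI)
    show "\<forall>A\<in>carrier GL. scalars #>\<^bsub>GL\<^esub> A = A <#\<^bsub>GL\<^esub> (scalars :: ('k^'n^'n) set)"
      by (auto simp: r_coset_def l_coset_def scalars_def GL_def mat_mult_commute)
  qed
qed

lemma group_PGL: "group (PGL :: ('k::field^'n::finite^'n) set monoid)"
  unfolding PGL_def by (rule normal.factorgroup_is_group[OF normal_scalars])

lemma carrier_PGL: "carrier PGL = proj ` {A :: 'k::field^'n::finite^'n. invertible A}"
  unfolding PGL_def carrier_FactGroup proj_def by (simp add: GL_def)

lemma proj_in_PGL [simp]: "invertible A \<Longrightarrow> proj A \<in> carrier PGL"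
  by (simp add: carrier_PGL)

lemma proj_mult:
  assumes "invertible A" "invertible B"
  shows "proj A \<otimes>\<^bsub>PGL\<^esub> proj B = proj (A ** B)"
  using normal.rcos_sum[OF normal_scalars, of A B] assms
  by (simp add: PGL_def proj_def GL_def)

lemma proj_eq_iff:
  fixes A B :: "'k::field^'n::finite^'n"
  assumes "invertible A" "invertible B"
  shows "proj A = proj B \<longleftrightarrow> (\<exists>c. c \<noteq> 0 \<and> B = mat c ** A)"
proof -
  interpret normal scalars "GL :: ('k^'n^'n) monoid" by (rule normal_scalars)
  have "A \<in> carrier GL" "B \<in> carrier GL" using assms by (simp_all add: GL_def)
  then have "proj A = proj B \<longleftrightarrow> B \<in> scalars #>\<^bsub>GL\<^esub> A"
    unfolding proj_def using repr_independence[OF _ _ subgroup_axioms] rcos_self[OF _ subgroup_axioms]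
    by metis
  then show ?thesis by (auto simp: r_coset_def scalars_def GL_def)
qed

lemma one_PGL: "\<one>\<^bsub>PGL\<^esub> = proj (mat 1 :: 'k::field^'n::finite^'n)"
proof -
  interpret group "PGL :: ('k^'n^'n) set monoid" by (rule group_PGL)
  have "proj (mat 1 :: 'k^'n^'n) \<otimes>\<^bsub>PGL\<^esub> proj (mat 1) = proj (mat 1)"
    by (simp add: proj_mult invertible_mat)
  then show ?thesis by (metis invertible_mat l_cancel_one proj_in_PGL zero_neq_one)
qed

lemma inv_proj:
  fixes A B :: "'k::field^'n::finite^'n"
  assumes "A ** B = mat 1" "B ** A = mat 1"
  shows "inv\<^bsub>PGL\<^esub> (proj A) = proj B"
proof -
  interpret group "PGL :: ('k^'n^'n) set monoid" by (rule group_PGL)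
  have "invertible A" "invertible B" using assms by (auto simp: invertible_def)
  then show ?thesis using assms by (intro inv_equality) (simp_all add: proj_mult one_PGL)
qed

lemma proj_mat_mult: "c \<noteq> 0 \<Longrightarrow> invertible A \<Longrightarrow> proj (mat c ** A) = proj A"
  by (metis invertible_mat invertible_mult proj_eq_iff)

lemma invertible_mono_mat: "bij w \<Longrightarrow> (\<And>i. t i \<noteq> 0) \<Longrightarrow> invertible (mono_mat t w)"
  unfolding invertible_def using mono_mat_inverse by blast

lemma monomial_group_eq: "monomial_group = {proj (mono_mat t w) | t w. (\<forall>i. t i \<noteq> 0) \<and> bij w}"
  by (simp add: monomial_group_def mono_mat_def)

lemma mono_mat_in_monomial_group:
  "bij w \<Longrightarrow> (\<And>i. t i \<noteq> 0) \<Longrightarrow> proj (mono_mat t w) \<in> monomial_group"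
  unfolding monomial_group_eq by blast

lemma monomial_group_subgroup: "subgroup monomial_group (PGL :: ('k::field^'n::finite^'n) set monoid)"
proof -
  interpret group "PGL :: ('k^'n^'n) set monoid" by (rule group_PGL)
  show ?thesis
  proof (rule subgroupI)
    show "monomial_group \<subseteq> carrier (PGL :: ('k^'n^'n) set monoid)"
      by (auto simp: monomial_group_eq invertible_mono_mat)
    have "proj (mono_mat (\<lambda>_. 1) id) \<in> (monomial_group :: ('k^'n^'n) set set)"
      by (intro mono_mat_in_monomial_group) auto
    then show "monomial_group \<noteq> ({} :: ('k^'n^'n) set set)" by blast
    fix g h :: "('k^'n^'n) set"
    assume g: "g \<in> monomial_group"
    then obtain t w where tw: "g = proj (mono_mat t w)" "\<And>i. t i \<noteq> 0" "bij w"
      by (auto simp: monomial_group_eq)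
    have "inv\<^bsub>PGL\<^esub> g = proj (mono_mat (\<lambda>l. inverse (t (w l))) (inv_into UNIV w))"
      unfolding tw(1) using mono_mat_inverse[OF tw(3,2)] by (rule inv_proj)
    then show "inv\<^bsub>PGL\<^esub> g \<in> monomial_group"
      using tw(2,3) by (simp add: mono_mat_in_monomial_group bij_imp_bij_inv)
    assume "h \<in> monomial_group"
    then obtain s u where su: "h = proj (mono_mat s u)" "\<And>i. s i \<noteq> 0" "bij u"
      by (auto simp: monomial_group_eq)
    have "g \<otimes>\<^bsub>PGL\<^esub> h = proj (mono_mat (\<lambda>l. t l * s (inv_into UNIV w l)) (w \<circ> u))"
      unfolding tw(1) su(1)
      by (simp add: proj_mult invertible_mono_mat tw su mono_mat_mult)
    then show "g \<otimes>\<^bsub>PGL\<^esub> h \<in> monomial_group"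
      using tw(2,3) su(2,3) by (simp add: mono_mat_in_monomial_group bij_comp)
  qed
qed

lemma elem_mat_nth: "elem_mat i j \<omega> $ k $ l = (if k = l then 1 else if k = i \<and> l = j then \<omega> else 0)"
  by (simp add: elem_mat_def)

lemma elem_mat_mult_nth:
  assumes "i \<noteq> j"
  shows "(elem_mat i j \<omega> ** A) $ k $ l = A $ k $ l + (if k = i then \<omega> * A $ j $ l else 0)"
proof -
  have "(elem_mat i j \<omega> ** A) $ k $ l = (\<Sum>m\<in>UNIV. (if m = k then A $ m $ l else 0) + (if m = j then if k = i then \<omega> * A $ m $ l else 0 else 0))"
    unfolding matrix_matrix_mult_def elem_mat_def vec_lambda_beta using assms
    by (intro sum.cong refl) simp
  then show ?thesis by (simp add: sum.distrib)
qed

lemma elem_mat_inverse: "i \<noteq> j \<Longrightarrow> elem_mat i j \<omega> ** elem_mat i j (- \<omega>) = mat 1"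
  by (auto simp: vec_eq_iff elem_mat_mult_nth elem_mat_nth mat_def)

lemma invertible_elem_mat: "i \<noteq> j \<Longrightarrow> invertible (elem_mat i j \<omega>)"
  unfolding invertible_def using elem_mat_inverse[of i j \<omega>] elem_mat_inverse[of i j "- \<omega>"] by auto

lemma mono_mat_mult_nth [simp]:
  assumes "bij w"
  shows "(mono_mat t w ** A) $ k $ l = t k * A $ inv_into UNIV w k $ l"
proof -
  have "(mono_mat t w ** A) $ k $ l
      = (\<Sum>m\<in>UNIV. if m = inv_into UNIV w k then t k * A $ inv_into UNIV w k $ l else 0)"
    unfolding matrix_matrix_mult_def vec_lambda_beta
    using assms by (intro sum.cong refl) (auto simp: bij_is_inj bij_is_surj surj_f_inv_f)
  then show ?thesis by simp
qed

lemma mono_mat_elem_mat: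
  assumes "bij w" "\<And>i. t i \<noteq> 0" "i \<noteq> j"
  shows "mono_mat t w ** elem_mat i j \<omega>
    = elem_mat (w i) (w j) (t (w i) * \<omega> / t (w j)) ** mono_mat t w"
proof -
  have ij: "w i \<noteq> w j" using assms by (meson bij_is_inj injD)
  have w: "k = w l \<longleftrightarrow> inv_into UNIV w k = l" for k l
    using assms(1) by (metis bij_inv_eq_iff)
  show ?thesis
    using assms ij
    by (auto simp: vec_eq_iff elem_mat_mult_nth[OF ij] elem_mat_nth w bij_is_inj bij_is_surj surj_f_inv_f)
qed

section \<open>Product of a subgroup with a normalizing one\<close>

context group begin

lemma set_mult_memE:
  assumes "x \<in> H <#> K" obtains h k where "h \<in> H" "k \<in> K" "x = h \<otimes> k"
  using assms by (auto simp: set_mult_def)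

lemma set_mult_memI: "h \<in> H \<Longrightarrow> k \<in> K \<Longrightarrow> h \<otimes> k \<in> H <#> K"
  by (auto simp: set_mult_def)

lemma inv_mult_cancel_left:
  assumes "x \<in> carrier G" "y \<in> carrier G"
  shows "inv x \<otimes> (x \<otimes> y) = y" "x \<otimes> (inv x \<otimes> y) = y"
  using assms by (simp_all flip: m_assoc)

lemma subgroup_set_mult:
  assumes "subgroup H G" "subgroup N G"
    and conj: "\<And>n u. n \<in> N \<Longrightarrow> u \<in> H \<Longrightarrow> n \<otimes> u \<otimes> inv n \<in> H"
  shows "subgroup (H <#> N) G"
proof -
  interpret H: subgroup H G by fact
  interpret N: subgroup N G by fact
  show ?thesis
  proof (rule subgroupI)
    show "H <#> N \<subseteq> carrier G" by (auto elim!: set_mult_memE)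
    show "H <#> N \<noteq> {}" using set_mult_memI[OF H.one_closed N.one_closed] by blast
    fix x y assume "x \<in> H <#> N"
    then obtain u n where un: "u \<in> H" "n \<in> N" "x = u \<otimes> n" by (rule set_mult_memE)
    have "inv x = (inv n \<otimes> inv u \<otimes> inv (inv n)) \<otimes> inv n"
      using un by (simp add: inv_mult_group m_assoc)
    moreover have "inv n \<otimes> inv u \<otimes> inv (inv n) \<in> H" using un by (intro conj) auto
    ultimately show "inv x \<in> H <#> N" using un set_mult_memI by (metis N.m_inv_closed)
    assume "y \<in> H <#> N"
    then obtain u' n' where un': "u' \<in> H" "n' \<in> N" "y = u' \<otimes> n'" by (rule set_mult_memE)
    have "x \<otimes> y = (u \<otimes> (n \<otimes> u' \<otimes> inv n)) \<otimes> (n \<otimes> n')"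
      using un un' by (simp add: m_assoc inv_mult_cancel_left)
    then show "x \<otimes> y \<in> H <#> N"
      using un un' conj[of n u'] set_mult_memI by (metis H.m_closed N.m_closed)
  qed
qed

end

section \<open>Valued fields and the action of the monomial group\<close>

locale valued_field =
  fixes v :: "'k::field \<Rightarrow> ereal"
  assumes v_zero: "v 0 = \<infinity>"
    and v_finite: "x \<noteq> 0 \<Longrightarrow> \<exists>r::real. v x = ereal r"
    and v_mult: "v (x * y) = v x + v y"
    and v_add: "min (v x) (v y) \<le> v (x + y)"
begin

text \<open>
  The absolute value turns the condition \<open>f\<^sub>x(a\<^sub>i\<^sub>j) \<le> v \<omega>\<close> into the homogeneous inequality
  \<open>av \<omega> * a\<^sub>j \<le> a\<^sub>i\<close>, which covers the boundary without case distinctions.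
\<close>

definition av :: "'k \<Rightarrow> real" where
  "av x = (if x = 0 then 0 else exp (- real_of_ereal (v x)))"

lemma av_nonneg [simp]: "0 \<le> av x"
  by (simp add: av_def)

lemma av_0 [simp]: "av 0 = 0"
  by (simp add: av_def)

lemma av_pos_iff [simp]: "0 < av x \<longleftrightarrow> x \<noteq> 0"
  by (simp add: av_def)

lemma av_eq_0_iff [simp]: "av x = 0 \<longleftrightarrow> x = 0"
  by (simp add: av_def)

lemma av_mult: "av (x * y) = av x * av y"
proof (cases "x = 0 \<or> y = 0")
  case False
  then obtain r s where "v x = ereal r" "v y = ereal s" using v_finite by blast
  then show ?thesis using False by (simp add: av_def v_mult flip: exp_add)
qed auto

lemma av_1 [simp]: "av 1 = 1"
proof -
  have "av 1 * av 1 = av 1 * 1" using av_mult[of 1 1] by simp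
  then show ?thesis by simp
qed

lemma av_minus [simp]: "av (- x) = av x"
proof -
  have "av (- 1) * av (- 1) = 1" using av_mult[of "- 1" "- 1"] by simp
  then have "av (- 1) = 1" using av_nonneg[of "- 1"] by (metis abs_of_nonneg abs_square_eq_1 power2_eq_square)
  then show ?thesis using av_mult[of "- 1" x] by simp
qed

lemma av_inverse: "av (inverse x) = inverse (av x)"
proof (cases "x = 0")
  case False
  then have "av x * av (inverse x) = 1" using av_mult[of x "inverse x"] by simp
  then show ?thesis by (metis inverse_unique)
qed simp

lemma av_divide: "av (x / y) = av x / av y"
  by (simp add: divide_inverse av_mult av_inverse)

lemma av_prod: "av (prod f S) = (\<Prod>i\<in>S. av (f i))"
  by (induction S rule: infinite_finite_induct) (auto simp: av_mult)

lemma av_add: "av (x + y) \<le> max (av x) (av y)"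
proof (cases "x = 0 \<or> y = 0 \<or> x + y = 0")
  case False
  then obtain r s q where "v x = ereal r" "v y = ereal s" "v (x + y) = ereal q"
    using v_finite by metis
  then show ?thesis using False v_add[of x y] by (auto simp: av_def min_def split: if_splits)
qed (auto simp: max_def)

lemma av_sum_le:
  assumes "\<And>i. i \<in> S \<Longrightarrow> av (f i) \<le> c" "0 \<le> c"
  shows "av (sum f S) \<le> c"
  using assms
proof (induction S rule: infinite_finite_induct)
  case (insert x F)
  then have "max (av (f x)) (av (sum f F)) \<le> c" by simp
  then show ?case using insert.hyps order_trans[OF av_add] by simp
qed auto

lemma root_fun_hpt_le_v_iff:
  assumes "a \<in> orthant" "i \<noteq> j"
  shows "root_fun (hpt a) i j \<le> v \<omega> \<longleftrightarrow> av \<omega> * a $ j \<le> a $ i"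
proof (cases "\<omega> = 0")
  case True
  then show ?thesis using assms by (simp add: v_zero orthant_def)
next
  case False
  then obtain r where r: "v \<omega> = ereal r" using v_finite by blast
  have "a $ j \<le> exp r * a $ i \<longleftrightarrow> exp (- r) * a $ j \<le> a $ i"
    by (simp add: exp_minus field_simps)
  then show ?thesis using root_fun_hpt_le_iff[OF assms] False r by (simp add: av_def)
qed

section \<open>The monomial group acting on homogeneous coordinates\<close>

abbreviation monomial_act :: "('n \<Rightarrow> 'k) \<Rightarrow> ('n \<Rightarrow> 'n) \<Rightarrow> real^'n::finite \<Rightarrow> real^'n" where
  "monomial_act t w a \<equiv> (\<chi> l. av (t l) * a $ inv_into UNIV w l)"

lemma monomial_act_orthant:
  assumes "bij w" "\<And>i. t i \<noteq> 0" "a \<in> orthant"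
  shows "monomial_act t w a \<in> orthant"
proof -
  obtain i where "a $ i \<noteq> 0" using assms(3) by (auto simp: orthant_def vec_eq_iff)
  then have "monomial_act t w a $ (w i) \<noteq> 0" using assms by (simp add: bij_is_inj)
  then have "monomial_act t w a \<noteq> 0" by (metis zero_index)
  then show ?thesis using assms by (simp add: orthant_def)
qed

lemma torus_act_pt: "torus_act v t (pt I x) = pt I (\<chi> i. x $ i - real_of_ereal (v (t i)))"
proof -
  define s where "s = (\<Sum>i\<in>I. real_of_ereal (v (t i)) *\<^sub>R eta i)"
  have s: "s $ i = real_of_ereal (v (t i))" if "i \<in> I" for i
    using that by (simp add: s_def eta_def axis_def sum.delta' if_distrib cong: if_cong)
  have "(\<lambda>y. y - s) ` {y. \<exists>c. \<forall>i\<in>I. y $ i = x $ i + c}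
      = {y. \<exists>c. \<forall>i\<in>I. y $ i = (\<chi> i. x $ i - real_of_ereal (v (t i))) $ i + c}" (is "?f ` ?A = ?B")
  proof
    show "?f ` ?A \<subseteq> ?B" using s by force
    show "?B \<subseteq> ?f ` ?A"
    proof
      fix y assume "y \<in> ?B"
      then obtain c where "\<forall>i\<in>I. y $ i = x $ i - real_of_ereal (v (t i)) + c" by auto
      then have "y + s \<in> ?A" using s by auto
      then show "y \<in> ?f ` ?A" by (rule rev_image_eqI) simp
    qed
  qed
  then show ?thesis by (simp add: torus_act_def pt_def s_def)
qed

lemma perm_act_pt: "bij w \<Longrightarrow> perm_act w (pt I x) = pt (w ` I) (\<chi> l. x $ inv_into UNIV w l)"
  by (simp add: perm_act_def pt_def bij_is_inj)

text \<open>Since \<open>av\<close> is \<open>exp\<close> of minus the valuation, translation by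
  \<open>- v (t l)\<close> becomes multiplication by \<open>av (t l)\<close>; coordinates equal to
  \<open>0\<close> remain \<open>0\<close>, so the formula is uniform on all pieces.\<close>

lemma torus_act_perm_act_hpt:
  assumes "bij w" "\<And>i. t i \<noteq> 0"
  shows "torus_act v t (perm_act w (hpt a)) = hpt (monomial_act t w a)"
proof -
  have "w ` {i. 0 < a $ i} = {l. 0 < a $ inv_into UNIV w l}"
    using bij_image_Collect_eq[OF assms(1), of "\<lambda>i. 0 < a $ i"] .
  moreover have "ln (av (t l) * a $ inv_into UNIV w l) = ln (a $ inv_into UNIV w l) - real_of_ereal (v (t l))"
    if "0 < a $ inv_into UNIV w l" for l
    using that assms(2)[of l] by (simp add: av_def ln_mult)
  ultimately show ?thesis
    unfolding hpt_def perm_act_pt[OF assms(1)] torus_act_pt pt_eq_iff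
    using assms(2) by (auto simp: zero_less_mult_iff leD[OF av_nonneg] intro: exI[of _ 0])
qed

text \<open>Well-definedness of the \<open>THE\<close> in \<open>nu\<close>: monomial matrices of
  the same class differ by a scalar \<open>c\<close>, comparing the positions of nonzero entries
  gives the same permutation, and \<open>c\<close> only multiplies the homogeneous coordinates by
  \<open>av c\<close>.\<close>

lemma nu_mono_mat:
  fixes a :: "real^'n::finite"
  assumes w: "bij w" and t: "\<And>i. t i \<noteq> 0"
  shows "nu v (proj (mono_mat t w)) (hpt a) = hpt (monomial_act t w a)"
  unfolding nu_def mono_mat_def[symmetric]
proof (rule the_equality)
  show "\<exists>t' w'. (\<forall>i. t' i \<noteq> 0) \<and> bij w' \<and> proj (mono_mat t w) = proj (mono_mat t' w') \<and>
      hpt (monomial_act t w a) = torus_act v t' (perm_act w' (hpt a))"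
    using torus_act_perm_act_hpt[OF w t] t w by (intro exI[of _ t] exI[of _ w]) simp
  fix z assume "\<exists>t' w'. (\<forall>i. t' i \<noteq> 0) \<and> bij w' \<and> proj (mono_mat t w) = proj (mono_mat t' w') \<and>
      z = torus_act v t' (perm_act w' (hpt a))"
  then obtain t' w' where t': "\<And>i. t' i \<noteq> 0" and w': "bij w'"
    and e: "proj (mono_mat t w) = proj (mono_mat t' w')"
    and z: "z = torus_act v t' (perm_act w' (hpt a))" by blast
  obtain c where c: "c \<noteq> 0" "mono_mat t' w' = mat c ** mono_mat t w"
    using e proj_eq_iff invertible_mono_mat w t w' t' by metis
  have nth: "(if i = w' j then t' i else 0) = c * (if i = w j then t i else 0)" for i j
    using arg_cong[OF c(2), of "\<lambda>A. A $ i $ j"] by simp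
  have "w j = w' j" for j using nth[of "w j" j] t c(1) by (auto split: if_splits)
  then have "w' = w" by auto
  then have "t' (w j) = c * t (w j)" for j using nth[of "w j" j] by simp
  then have tt: "t' l = c * t l" for l using w by (metis bij_pointE)
  have "z = hpt (monomial_act t' w a)" using z torus_act_perm_act_hpt[OF w t'] \<open>w' = w\<close> by simp
  also have "monomial_act t' w a = av c *\<^sub>R monomial_act t w a"
    by (simp add: vec_eq_iff tt av_mult)
  finally show "z = hpt (monomial_act t w a)" using c(1) by (simp add: hpt_scale)
qed

lemma cpt_apartment_cases:
  assumes "z \<in> cpt_apartment" obtains a where "a \<in> orthant" "z = hpt a"
  using assms hpt_cube_face cube_face_orthant by blast

lemma nu_one: "z \<in> cpt_apartment \<Longrightarrow> nu v \<one>\<^bsub>PGL\<^esub> z = z"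
  unfolding one_PGL mono_mat_1[symmetric]
  by (erule cpt_apartment_cases) (simp add: nu_mono_mat)

lemma nu_mult:
  assumes "g \<in> monomial_group" "h \<in> monomial_group" "z \<in> cpt_apartment"
  shows "nu v (g \<otimes>\<^bsub>PGL\<^esub> h) z = nu v g (nu v h z)"
proof -
  obtain t w where tw: "g = proj (mono_mat t w)" "\<And>i. t i \<noteq> 0" "bij w"
    using assms by (auto simp: monomial_group_eq)
  obtain s u where su: "h = proj (mono_mat s u)" "\<And>i. s i \<noteq> 0" "bij u"
    using assms by (auto simp: monomial_group_eq)
  obtain a where a: "z = hpt a" using assms cpt_apartment_cases by blast
  have "monomial_act t w (monomial_act s u a) = monomial_act (\<lambda>l. t l * s (inv_into UNIV w l)) (w \<circ> u) a"
    by (simp add: vec_eq_iff av_mult o_inv_distrib tw su)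
  then show ?thesis
    by (simp add: tw su a proj_mult invertible_mono_mat mono_mat_mult nu_mono_mat bij_comp)
qed

end

section \<open>Groups attached to points\<close>

context valued_field begin

definition root_elems :: "real^'n::finite \<Rightarrow> ('k^'n^'n) set set" where
  "root_elems a = {proj (elem_mat i j \<omega>) | i j \<omega>. i \<noteq> j \<and> av \<omega> * a $ j \<le> a $ i}"

lemma U_pt_hpt: 
  assumes "a \<in> orthant" shows "U_pt v (hpt a) = generate PGL (root_elems a)"
proof -
  have "(\<Union>(i, j)\<in>{(i, j). i \<noteq> j}. root_subgroup v (hpt a) i j) = root_elems a"
    using root_fun_hpt_le_v_iff[OF assms] unfolding root_subgroup_def root_elems_def by blast
  then show ?thesis by (simp add: U_pt_def)
qed

lemma root_elems_carrier: "root_elems a \<subseteq> carrier PGL"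
  by (auto simp: root_elems_def invertible_elem_mat)

lemma U_pt_subgroup:
  "z \<in> cpt_apartment \<Longrightarrow> subgroup (U_pt v z) (PGL :: ('k^'n::finite^'n) set monoid)"
  by (erule cpt_apartment_cases)
    (simp add: U_pt_hpt group.generate_is_subgroup[OF group_PGL] root_elems_carrier)

lemma nu_inv:
  assumes "g \<in> monomial_group" "z \<in> (cpt_apartment :: 'n::finite apt_point set)"
  shows "nu v (inv\<^bsub>PGL\<^esub> g) (nu v g z) = z"
proof -
  interpret group "PGL :: ('k^'n^'n) set monoid" by (rule group_PGL)
  interpret N: subgroup monomial_group "PGL :: ('k^'n^'n) set monoid" by (rule monomial_group_subgroup)
  show ?thesis using nu_mult[of "inv\<^bsub>PGL\<^esub> g" g z] assms by (simp add: nu_one)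
qed

lemma N_pt_subgroup:
  assumes z: "z \<in> cpt_apartment"
  shows "subgroup (N_pt v z) (PGL :: ('k^'n::finite^'n) set monoid)"
proof -
  interpret group "PGL :: ('k^'n^'n) set monoid" by (rule group_PGL)
  interpret N: subgroup monomial_group "PGL :: ('k^'n^'n) set monoid" by (rule monomial_group_subgroup)
  show ?thesis
  proof (rule subgroupI)
    show "N_pt v z \<subseteq> carrier (PGL :: ('k^'n^'n) set monoid)" by (auto simp: N_pt_def)
    have "\<one>\<^bsub>PGL\<^esub> \<in> N_pt v z" using z by (simp add: N_pt_def nu_one)
    then show "N_pt v z \<noteq> ({} :: ('k^'n^'n) set set)" by (metis empty_iff)
    fix g h :: "('k^'n^'n) set"
    assume g: "g \<in> N_pt v z"
    then show "inv\<^bsub>PGL\<^esub> g \<in> N_pt v z" using nu_inv[of g z] z by (simp add: N_pt_def)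
    assume "h \<in> N_pt v z"
    then show "g \<otimes>\<^bsub>PGL\<^esub> h \<in> N_pt v z" using g z by (simp add: N_pt_def nu_mult)
  qed
qed

text \<open>Conjugation by \<open>mono_mat t w\<close> carries the root group of
  \<open>(i, j)\<close> to that of \<open>(w i, w j)\<close> and rescales the parameter by
  \<open>t (w i) / t (w j)\<close>; in terms of the coordinates of the moved point, the defining
  inequality is merely multiplied by \<open>av (t (w i))\<close>.\<close>

lemma conj_U_pt:
  assumes m: "m \<in> monomial_group" and z: "z \<in> cpt_apartment" and u: "u \<in> U_pt v z"
  shows "m \<otimes>\<^bsub>PGL\<^esub> u \<otimes>\<^bsub>PGL\<^esub> inv\<^bsub>PGL\<^esub> m \<in> U_pt v (nu v m z :: 'n::finite apt_point)"
proof -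
  interpret group "PGL :: ('k^'n^'n) set monoid" by (rule group_PGL)
  interpret N: subgroup monomial_group "PGL :: ('k^'n^'n) set monoid" by (rule monomial_group_subgroup)
  obtain a where a: "a \<in> orthant" "z = hpt a" using z by (rule cpt_apartment_cases)
  obtain t w where tw: "m = proj (mono_mat t w)" "\<And>i. t i \<noteq> 0" "bij w"
    using m by (auto simp: monomial_group_eq)
  define b where "b = monomial_act t w a"
  have b: "b \<in> orthant" "nu v m z = hpt b"
    using tw a by (simp_all add: b_def monomial_act_orthant nu_mono_mat)
  have mc: "m \<in> carrier PGL" using m by (rule N.mem_carrier)
  have root: "m \<otimes>\<^bsub>PGL\<^esub> g \<otimes>\<^bsub>PGL\<^esub> inv\<^bsub>PGL\<^esub> m \<in> root_elems b" if g: "g \<in> root_elems a" for g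
  proof -
    obtain i j \<omega> where ij: "g = proj (elem_mat i j \<omega>)" "i \<noteq> j" "av \<omega> * a $ j \<le> a $ i"
      using g unfolding root_elems_def by blast
    define \<omega>' where "\<omega>' = t (w i) * \<omega> / t (w j)"
    have wij: "w i \<noteq> w j" using ij(2) tw(3) by (meson bij_is_inj injD)
    have "m \<otimes>\<^bsub>PGL\<^esub> g = proj (elem_mat (w i) (w j) \<omega>') \<otimes>\<^bsub>PGL\<^esub> m"
      using ij(2) wij tw
      by (simp add: ij(1) tw(1) proj_mult invertible_mono_mat invertible_elem_mat mono_mat_elem_mat \<omega>'_def)
    then have "m \<otimes>\<^bsub>PGL\<^esub> g \<otimes>\<^bsub>PGL\<^esub> inv\<^bsub>PGL\<^esub> m = proj (elem_mat (w i) (w j) \<omega>')"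
      using mc wij by (simp add: inv_solve_right' invertible_elem_mat m_assoc)
    moreover have "av \<omega>' * b $ w j \<le> b $ w i"
    proof -
      have "av \<omega>' * b $ w j = av (t (w i)) * (av \<omega> * a $ j)"
        using tw(2,3) by (simp add: b_def \<omega>'_def av_mult av_divide bij_is_inj)
      also have "\<dots> \<le> av (t (w i)) * a $ i" using ij(3) by (intro mult_left_mono) auto
      also have "\<dots> = b $ w i" using tw(3) by (simp add: b_def bij_is_inj)
      finally show ?thesis .
    qed
    ultimately show ?thesis unfolding root_elems_def using wij by blast
  qed
  have "u \<in> generate PGL (root_elems a)" using u a by (simp add: U_pt_hpt)
  then have "m \<otimes>\<^bsub>PGL\<^esub> u \<otimes>\<^bsub>PGL\<^esub> inv\<^bsub>PGL\<^esub> m \<in> generate PGL (root_elems b)"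
  proof induction
    case one
    then show ?case using mc generate.one[of PGL] by simp
  next
    case (incl h)
    then show ?case by (intro generate.incl root)
  next
    case (inv h)
    then have h: "h \<in> carrier PGL" using root_elems_carrier by blast
    have "m \<otimes>\<^bsub>PGL\<^esub> inv\<^bsub>PGL\<^esub> h \<otimes>\<^bsub>PGL\<^esub> inv\<^bsub>PGL\<^esub> m = inv\<^bsub>PGL\<^esub> (m \<otimes>\<^bsub>PGL\<^esub> h \<otimes>\<^bsub>PGL\<^esub> inv\<^bsub>PGL\<^esub> m)"
      using h mc by (simp add: inv_mult_group m_assoc)
    then show ?case using inv by (simp add: generate.inv root)
  next
    case (eng h1 h2)
    then have h: "h1 \<in> carrier PGL" "h2 \<in> carrier PGL"
      using generate_in_carrier[OF root_elems_carrier] by blast+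
    have "m \<otimes>\<^bsub>PGL\<^esub> (h1 \<otimes>\<^bsub>PGL\<^esub> h2) \<otimes>\<^bsub>PGL\<^esub> inv\<^bsub>PGL\<^esub> m
        = (m \<otimes>\<^bsub>PGL\<^esub> h1 \<otimes>\<^bsub>PGL\<^esub> inv\<^bsub>PGL\<^esub> m) \<otimes>\<^bsub>PGL\<^esub> (m \<otimes>\<^bsub>PGL\<^esub> h2 \<otimes>\<^bsub>PGL\<^esub> inv\<^bsub>PGL\<^esub> m)"
      using h mc by (simp add: m_assoc inv_mult_cancel_left)
    then show ?case using generate.eng[OF eng.IH] by simp
  qed
  then show ?thesis using b by (simp add: U_pt_hpt)
qed

section \<open>The groups \<open>P_x\<close> and the equivalence relation\<close>

lemma P_pt_subgroup:
  assumes z: "z \<in> cpt_apartment"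
  shows "subgroup (P_pt v z) (PGL :: ('k^'n::finite^'n) set monoid)"
proof -
  interpret group "PGL :: ('k^'n^'n) set monoid" by (rule group_PGL)
  interpret U: subgroup "U_pt v z" "PGL :: ('k^'n^'n) set monoid" using z by (rule U_pt_subgroup)
  interpret N: subgroup "N_pt v z" "PGL :: ('k^'n^'n) set monoid" using z by (rule N_pt_subgroup)
  have conj: "n \<otimes>\<^bsub>PGL\<^esub> u \<otimes>\<^bsub>PGL\<^esub> inv\<^bsub>PGL\<^esub> n \<in> U_pt v z" if "n \<in> N_pt v z" "u \<in> U_pt v z" for n u
    using conj_U_pt[of n z u] that z by (simp add: N_pt_def)
  show ?thesis unfolding P_pt_def
    by (intro subgroup_set_mult U.subgroup_axioms N.subgroup_axioms conj)
qed

lemma conj_P_pt: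
  assumes m: "m \<in> monomial_group" and z: "z \<in> cpt_apartment" and g: "g \<in> P_pt v z"
  shows "m \<otimes>\<^bsub>PGL\<^esub> g \<otimes>\<^bsub>PGL\<^esub> inv\<^bsub>PGL\<^esub> m \<in> P_pt v (nu v m z :: 'n::finite apt_point)"
proof -
  interpret group "PGL :: ('k^'n^'n) set monoid" by (rule group_PGL)
  interpret N: subgroup monomial_group "PGL :: ('k^'n^'n) set monoid" by (rule monomial_group_subgroup)
  obtain u n where un: "u \<in> U_pt v z" "n \<in> N_pt v z" "g = u \<otimes>\<^bsub>PGL\<^esub> n"
    using g unfolding P_pt_def by (rule set_mult_memE)
  have c: "m \<in> carrier PGL" "u \<in> carrier PGL" "n \<in> carrier PGL"
    using m un subgroup.mem_carrier[OF U_pt_subgroup[OF z]] subgroup.mem_carrier[OF N_pt_subgroup[OF z]]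
    by auto
  have n: "n \<in> monomial_group" "nu v n z = z" using un by (auto simp: N_pt_def)
  have "nu v (m \<otimes>\<^bsub>PGL\<^esub> n \<otimes>\<^bsub>PGL\<^esub> inv\<^bsub>PGL\<^esub> m) (nu v m z)
      = nu v (m \<otimes>\<^bsub>PGL\<^esub> n \<otimes>\<^bsub>PGL\<^esub> inv\<^bsub>PGL\<^esub> m \<otimes>\<^bsub>PGL\<^esub> m) z"
    using m n z by (simp add: nu_mult)
  also have "m \<otimes>\<^bsub>PGL\<^esub> n \<otimes>\<^bsub>PGL\<^esub> inv\<^bsub>PGL\<^esub> m \<otimes>\<^bsub>PGL\<^esub> m = m \<otimes>\<^bsub>PGL\<^esub> n"
    using c by (simp add: m_assoc)
  also have "nu v (m \<otimes>\<^bsub>PGL\<^esub> n) z = nu v m z" using m n z by (simp add: nu_mult)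
  finally have "m \<otimes>\<^bsub>PGL\<^esub> n \<otimes>\<^bsub>PGL\<^esub> inv\<^bsub>PGL\<^esub> m \<in> N_pt v (nu v m z)"
    using m n by (simp add: N_pt_def)
  moreover have "m \<otimes>\<^bsub>PGL\<^esub> g \<otimes>\<^bsub>PGL\<^esub> inv\<^bsub>PGL\<^esub> m
      = (m \<otimes>\<^bsub>PGL\<^esub> u \<otimes>\<^bsub>PGL\<^esub> inv\<^bsub>PGL\<^esub> m) \<otimes>\<^bsub>PGL\<^esub> (m \<otimes>\<^bsub>PGL\<^esub> n \<otimes>\<^bsub>PGL\<^esub> inv\<^bsub>PGL\<^esub> m)"
    using c by (simp add: un(3) m_assoc inv_mult_cancel_left)
  ultimately show ?thesis unfolding P_pt_def using conj_U_pt[OF m z un(1)] set_mult_memI by metis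
qed

lemma pt_0: "pt UNIV 0 = hpt (\<chi> i. 1)"
  by (simp add: pt_eq_hpt)

lemma ones_cube_face: "(\<chi> i. 1) \<in> cube_face"
  by (simp add: cube_face_iff)

lemma pt_0_cpt: "pt UNIV 0 \<in> cpt_apartment"
  using hpt_cube_face ones_cube_face pt_0 by (metis imageI)

lemma U0_hat_carrier: "U0_hat v \<subseteq> carrier (PGL :: ('k^'n::finite^'n) set monoid)"
proof -
  interpret group "PGL :: ('k^'n^'n) set monoid" by (rule group_PGL)
  interpret U: subgroup "U_pt v (pt UNIV 0)" "PGL :: ('k^'n^'n) set monoid"
    by (rule U_pt_subgroup) (rule pt_0_cpt)
  have "diag_mat t = mono_mat t id" for t :: "'n \<Rightarrow> 'k"
    by (simp add: vec_eq_iff diag_mat_def)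
  then have "torus \<subseteq> carrier (PGL :: ('k^'n^'n) set monoid)"
    by (auto simp: torus_def invertible_mono_mat)
  then show ?thesis unfolding U0_hat_def Z_group_def by (auto elim!: set_mult_memE)
qed

text \<open>The defining condition refers to the group at the first point only. Conjugation by the
  monomial element or its inverse moves it between the groups at the two points, which gives
  symmetry and transitivity.\<close>

lemma equiv_building_rel:
  "equiv (U0_hat v \<times> cpt_apartment) (building_rel v :: ((('k^'n::finite^'n) set \<times> 'n apt_point) \<times> _) set)"
proof (rule equivI)
  interpret group "PGL :: ('k^'n^'n) set monoid" by (rule group_PGL)
  interpret N: subgroup monomial_group "PGL :: ('k^'n^'n) set monoid" by (rule monomial_group_subgroup)
  have C: "g \<in> carrier PGL" if "g \<in> U0_hat v" for g :: "('k^'n^'n) set"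
    using that U0_hat_carrier by blast
  let ?R = "building_rel v :: ((('k^'n^'n) set \<times> 'n apt_point) \<times> _) set"
  show "?R \<subseteq> (U0_hat v \<times> cpt_apartment) \<times> (U0_hat v \<times> cpt_apartment)"
    by (auto simp: building_rel_def)
  show "refl_on (U0_hat v \<times> cpt_apartment) ?R"
  proof (rule refl_onI)
    fix x :: "('k^'n^'n) set \<times> 'n apt_point"
    assume x: "x \<in> U0_hat v \<times> cpt_apartment"
    then have "inv\<^bsub>PGL\<^esub> (fst x) \<otimes>\<^bsub>PGL\<^esub> fst x \<otimes>\<^bsub>PGL\<^esub> \<one>\<^bsub>PGL\<^esub> \<in> P_pt v (snd x)"
      using subgroup.one_closed[OF P_pt_subgroup[of "snd x"]] C by auto
    then show "(x, x) \<in> ?R"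
      using x nu_one by (auto simp: building_rel_def intro!: bexI[of _ "\<one>\<^bsub>PGL\<^esub>"])
  qed
  show "sym ?R"
  proof (rule symI)
    fix a b assume "(a, b) \<in> ?R"
    then obtain g x h y m where ab: "a = (g, x)" "b = (h, y)" "g \<in> U0_hat v" "x \<in> cpt_apartment"
        "h \<in> U0_hat v" "y \<in> cpt_apartment"
      and m: "m \<in> monomial_group" "nu v m x = y" "inv\<^bsub>PGL\<^esub> g \<otimes>\<^bsub>PGL\<^esub> h \<otimes>\<^bsub>PGL\<^esub> m \<in> P_pt v x"
      by (auto simp: building_rel_def)
    let ?m = "inv\<^bsub>PGL\<^esub> m"
    have c: "g \<in> carrier PGL" "h \<in> carrier PGL" "m \<in> carrier PGL" using ab m C by auto
    have "m \<otimes>\<^bsub>PGL\<^esub> inv\<^bsub>PGL\<^esub> (inv\<^bsub>PGL\<^esub> g \<otimes>\<^bsub>PGL\<^esub> h \<otimes>\<^bsub>PGL\<^esub> m) \<otimes>\<^bsub>PGL\<^esub> inv\<^bsub>PGL\<^esub> m \<in> P_pt v y"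
      using conj_P_pt[OF m(1) ab(4) subgroup.m_inv_closed[OF P_pt_subgroup[OF ab(4)] m(3)]] m(2) by simp
    also have "m \<otimes>\<^bsub>PGL\<^esub> inv\<^bsub>PGL\<^esub> (inv\<^bsub>PGL\<^esub> g \<otimes>\<^bsub>PGL\<^esub> h \<otimes>\<^bsub>PGL\<^esub> m) \<otimes>\<^bsub>PGL\<^esub> inv\<^bsub>PGL\<^esub> m
        = inv\<^bsub>PGL\<^esub> h \<otimes>\<^bsub>PGL\<^esub> g \<otimes>\<^bsub>PGL\<^esub> ?m"
      using c by (simp add: inv_mult_group m_assoc inv_mult_cancel_left)
    finally have "inv\<^bsub>PGL\<^esub> h \<otimes>\<^bsub>PGL\<^esub> g \<otimes>\<^bsub>PGL\<^esub> ?m \<in> P_pt v y" .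
    moreover have "nu v ?m y = x" using nu_inv[OF m(1) ab(4)] m(2) by simp
    ultimately show "(b, a) \<in> ?R" using ab m(1) by (auto simp: building_rel_def intro!: bexI[of _ ?m])
  qed
  show "trans ?R"
  proof (rule transI)
    fix a b c assume "(a, b) \<in> ?R" "(b, c) \<in> ?R"
    then obtain g x h y m k z l where ab: "a = (g, x)" "b = (h, y)" "g \<in> U0_hat v" "x \<in> cpt_apartment"
        "h \<in> U0_hat v" "y \<in> cpt_apartment" "c = (k, z)" "k \<in> U0_hat v" "z \<in> cpt_apartment"
      and m: "m \<in> monomial_group" "nu v m x = y" "inv\<^bsub>PGL\<^esub> g \<otimes>\<^bsub>PGL\<^esub> h \<otimes>\<^bsub>PGL\<^esub> m \<in> P_pt v x"
      and l: "l \<in> monomial_group" "nu v l y = z" "inv\<^bsub>PGL\<^esub> h \<otimes>\<^bsub>PGL\<^esub> k \<otimes>\<^bsub>PGL\<^esub> l \<in> P_pt v y"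
      by (auto simp: building_rel_def)
    have c: "g \<in> carrier PGL" "h \<in> carrier PGL" "k \<in> carrier PGL" "m \<in> carrier PGL" "l \<in> carrier PGL"
      using ab m l C by auto
    have "nu v (inv\<^bsub>PGL\<^esub> m) y = x" using nu_inv[OF m(1) ab(4)] m(2) by simp
    then have "inv\<^bsub>PGL\<^esub> m \<otimes>\<^bsub>PGL\<^esub> (inv\<^bsub>PGL\<^esub> h \<otimes>\<^bsub>PGL\<^esub> k \<otimes>\<^bsub>PGL\<^esub> l) \<otimes>\<^bsub>PGL\<^esub> m \<in> P_pt v x"
      using conj_P_pt[of "inv\<^bsub>PGL\<^esub> m", OF _ ab(6) l(3)] m(1) c by simp
    with m(3) have "(inv\<^bsub>PGL\<^esub> g \<otimes>\<^bsub>PGL\<^esub> h \<otimes>\<^bsub>PGL\<^esub> m) \<otimes>\<^bsub>PGL\<^esub>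
        (inv\<^bsub>PGL\<^esub> m \<otimes>\<^bsub>PGL\<^esub> (inv\<^bsub>PGL\<^esub> h \<otimes>\<^bsub>PGL\<^esub> k \<otimes>\<^bsub>PGL\<^esub> l) \<otimes>\<^bsub>PGL\<^esub> m) \<in> P_pt v x"
      by (rule subgroup.m_closed[OF P_pt_subgroup[OF ab(4)]])
    also have "(inv\<^bsub>PGL\<^esub> g \<otimes>\<^bsub>PGL\<^esub> h \<otimes>\<^bsub>PGL\<^esub> m) \<otimes>\<^bsub>PGL\<^esub>
        (inv\<^bsub>PGL\<^esub> m \<otimes>\<^bsub>PGL\<^esub> (inv\<^bsub>PGL\<^esub> h \<otimes>\<^bsub>PGL\<^esub> k \<otimes>\<^bsub>PGL\<^esub> l) \<otimes>\<^bsub>PGL\<^esub> m)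
        = inv\<^bsub>PGL\<^esub> g \<otimes>\<^bsub>PGL\<^esub> k \<otimes>\<^bsub>PGL\<^esub> (l \<otimes>\<^bsub>PGL\<^esub> m)"
      using c by (simp add: m_assoc inv_mult_cancel_left)
    finally have "inv\<^bsub>PGL\<^esub> g \<otimes>\<^bsub>PGL\<^esub> k \<otimes>\<^bsub>PGL\<^esub> (l \<otimes>\<^bsub>PGL\<^esub> m) \<in> P_pt v x" .
    moreover have "nu v (l \<otimes>\<^bsub>PGL\<^esub> m) x = z" using m l ab by (simp add: nu_mult)
    ultimately show "(a, c) \<in> ?R"
      using ab m(1) l(1) by (auto simp: building_rel_def intro!: bexI[of _ "l \<otimes>\<^bsub>PGL\<^esub> m"])
  qed
qed

section \<open>Matrices bounded with respect to two points\<close>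

definition bounded_mat :: "real^'n::finite \<Rightarrow> real^'n \<Rightarrow> 'k^'n^'n \<Rightarrow> bool" where
  "bounded_mat a b A \<longleftrightarrow> (\<forall>i j. av (A $ i $ j) * b $ j \<le> a $ i)"

text \<open>For positive weights, \<open>bounded_mat a b A\<close> says that \<open>A\<close> has
  operator norm at most \<open>1\<close> from the norm \<open>max \<bar>x_j\<bar> / b_j\<close> to
  the norm \<open>max \<bar>x_i\<bar> / a_i\<close>, and \<open>biunit a b\<close> consists of the
  isometries between them. The multiplied-out form also makes sense for vanishing weights. With all
  weights \<open>1\<close> one gets the invertible matrices over the valuation ring.\<close>

definition biunit :: "real^'n::finite \<Rightarrow> real^'n \<Rightarrow> ('k^'n^'n) set" where
  "biunit a b = {A. \<exists>B. A ** B = mat 1 \<and> B ** A = mat 1 \<and> bounded_mat a b A \<and> bounded_mat b a B}"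

lemma bounded_mat_mult:
  assumes "bounded_mat a b A" "bounded_mat b c B" "\<And>i. 0 \<le> a $ i" "\<And>i. 0 \<le> c $ i"
  shows "bounded_mat a c (A ** B)"
  unfolding bounded_mat_def
proof (intro allI)
  fix i j
  have *: "av (A $ i $ k * B $ k $ j) * c $ j \<le> a $ i" for k
  proof -
    have "av (A $ i $ k) * (av (B $ k $ j) * c $ j) \<le> av (A $ i $ k) * b $ k"
      using assms(2) by (intro mult_left_mono) (auto simp: bounded_mat_def)
    also have "\<dots> \<le> a $ i" using assms(1) by (simp add: bounded_mat_def)
    finally show ?thesis by (simp add: av_mult mult_ac)
  qed
  show "av ((A ** B) $ i $ j) * c $ j \<le> a $ i"
  \<comment> \<open>For weight \<open>0\<close> the left side vanishes; otherwise dividing by the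
    weight gives all terms of the sum a common bound, as the ultrametric inequality
    requires.\<close>
  proof (cases "c $ j = 0")
    case False
    then have "0 < c $ j" using assms(4)[of j] by simp
    then have "av (A $ i $ k * B $ k $ j) \<le> a $ i / c $ j" for k using *[of k] by (simp add: field_simps)
    then have "av (\<Sum>k\<in>UNIV. A $ i $ k * B $ k $ j) \<le> a $ i / c $ j"
      using assms(3) \<open>0 < c $ j\<close> by (intro av_sum_le) simp_all
    then show ?thesis using \<open>0 < c $ j\<close> by (simp add: matrix_matrix_mult_def field_simps)
  qed (use assms(3) in simp)
qed

lemma biunit_invertible: "A \<in> biunit a b \<Longrightarrow> invertible A"
  by (auto simp: biunit_def invertible_def)

lemma biunit_mult:
  assumes "A \<in> biunit a b" "B \<in> biunit b c" "\<And>i. 0 \<le> a $ i" "\<And>i. 0 \<le> c $ i"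
  shows "A ** B \<in> biunit a c"
proof -
  obtain A' where A': "A ** A' = mat 1" "A' ** A = mat 1" "bounded_mat a b A" "bounded_mat b a A'"
    using assms(1) by (auto simp: biunit_def)
  obtain B' where B': "B ** B' = mat 1" "B' ** B = mat 1" "bounded_mat b c B" "bounded_mat c b B'"
    using assms(2) by (auto simp: biunit_def)
  have "(A ** B) ** (B' ** A') = A ** (B ** B') ** A'" "(B' ** A') ** (A ** B) = B' ** (A' ** A) ** B"
    by (simp_all only: matrix_mul_assoc)
  then have "(A ** B) ** (B' ** A') = mat 1" "(B' ** A') ** (A ** B) = mat 1"
    using A' B' by simp_all
  then show ?thesis unfolding biunit_def
    using bounded_mat_mult[OF A'(3) B'(3)] bounded_mat_mult[OF B'(4) A'(4)] assms(3,4) by blast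
qed

lemma biunit_inverse:
  assumes "A \<in> biunit a b" "A ** B = mat 1" "B ** A = mat 1"
  shows "B \<in> biunit b a"
proof -
  obtain A' where A': "A ** A' = mat 1" "A' ** A = mat 1" "bounded_mat a b A" "bounded_mat b a A'"
    using assms(1) by (auto simp: biunit_def)
  have "B = B ** (A ** A')" using A' by simp
  also have "\<dots> = A'" by (simp add: matrix_mul_assoc assms)
  finally show ?thesis using A' by (auto simp: biunit_def)
qed

lemma mat_1_biunit:
  assumes "\<And>i. 0 \<le> a $ i" shows "mat 1 \<in> biunit a a"
proof -
  have "bounded_mat a a (mat 1)" using assms by (simp add: bounded_mat_def mat_def)
  then show ?thesis unfolding biunit_def by (intro CollectI exI[of _ "mat 1"]) simp
qed

lemma elem_mat_biunit:
  assumes "\<And>i. 0 \<le> a $ i" "i \<noteq> j" "av \<omega> * a $ j \<le> a $ i"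
  shows "elem_mat i j \<omega> \<in> biunit a a"
  unfolding biunit_def using elem_mat_inverse[OF assms(2), of \<omega>] elem_mat_inverse[OF assms(2), of "- \<omega>"] assms
  by (intro CollectI exI[of _ "elem_mat i j (- \<omega>)"]) (auto simp: bounded_mat_def elem_mat_nth)

lemma mono_mat_biunit:
  assumes w: "bij w" and t: "\<And>i. t i \<noteq> 0" and a: "\<And>i. 0 \<le> a $ i"
  shows "mono_mat t w \<in> biunit (monomial_act t w a) a"
  unfolding biunit_def
proof (intro CollectI exI conjI)
  show "mono_mat t w ** mono_mat (\<lambda>l. inverse (t (w l))) (inv_into UNIV w) = mat 1"
    "mono_mat (\<lambda>l. inverse (t (w l))) (inv_into UNIV w) ** mono_mat t w = mat 1"
    using mono_mat_inverse[OF w t] .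
  show "bounded_mat (monomial_act t w a) a (mono_mat t w)"
    using w a by (auto simp: bounded_mat_def bij_is_inj)
  show "bounded_mat a (monomial_act t w a) (mono_mat (\<lambda>l. inverse (t (w l))) (inv_into UNIV w))"
    using w a t by (auto simp: bounded_mat_def av_inverse bij_is_surj surj_f_inv_f simp flip: mult.assoc)
qed

lemma U_pt_biunit:
  assumes a: "a \<in> orthant" and g: "g \<in> U_pt v (hpt a)"
  obtains B where "B \<in> biunit a a" "g = proj B"
proof -
  have nn: "0 \<le> a $ i" for i using a by (simp add: orthant_def)
  have root: "\<exists>B \<in> biunit a a. h = proj B" if "h \<in> root_elems a" for h
    using that elem_mat_biunit[OF nn] by (auto simp: root_elems_def)
  have "g \<in> generate PGL (root_elems a)" using g a by (simp add: U_pt_hpt)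
  then have "\<exists>B \<in> biunit a a. g = proj B"
  proof induction
    case one
    then show ?case using mat_1_biunit[OF nn] one_PGL by blast
  next
    case (incl h)
    then show ?case by (rule root)
  next
    case (inv h)
    then obtain B where B: "B \<in> biunit a a" "h = proj B" using root by blast
    obtain B' where B': "B ** B' = mat 1" "B' ** B = mat 1" using B(1) by (auto simp: biunit_def)
    show ?case using biunit_inverse[OF B(1) B'] inv_proj[OF B'] B(2) by blast
  next
    case (eng g h)
    then obtain B C where "B \<in> biunit a a" "g = proj B" "C \<in> biunit a a" "h = proj C" by blast
    then show ?case using biunit_mult[OF _ _ nn nn] by (metis biunit_invertible proj_mult)
  qed
  then show ?thesis using that by blast
qed

text \<open>An element of \<open>Z_group\<close> fixes the origin, so its diagonal entries share one
  absolute value; dividing by one of them leaves the class in \<open>PGL\<close> unchanged and makes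
  all entries units.\<close>

lemma U0_hat_biunit:
  fixes g :: "('k^'n::finite^'n) set"
  assumes g: "g \<in> U0_hat v"
  obtains B where "B \<in> biunit (\<chi> i. 1) (\<chi> i. 1)" "g = proj B"
proof -
  interpret group "PGL :: ('k^'n^'n) set monoid" by (rule group_PGL)
  let ?e = "(\<chi> i. 1) :: real^'n"
  have e: "?e \<in> orthant" using ones_cube_face by (rule cube_face_orthant)
  obtain u z where uz: "u \<in> U_pt v (pt UNIV 0)" "z \<in> Z_group v" "g = u \<otimes>\<^bsub>PGL\<^esub> z"
    using g unfolding U0_hat_def by (rule set_mult_memE)
  obtain B where B: "B \<in> biunit ?e ?e" "u = proj B"
    using U_pt_biunit[OF e] uz(1) unfolding pt_0 by blast
  obtain t where t: "z = proj (diag_mat t)" "\<And>i. t i \<noteq> 0"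
    using uz(2) unfolding Z_group_def torus_def by blast
  have "diag_mat t = mono_mat t id" by (simp add: vec_eq_iff diag_mat_def)
  then have z: "z = proj (mono_mat t id)" using t by simp
  have "nu v z (pt UNIV 0) = pt UNIV 0"
    using uz(2) unfolding Z_group_def piece_def by blast
  then have "hpt ?e = hpt (monomial_act t id ?e)"
    using nu_mono_mat[of id t ?e] t by (simp add: pt_0 z)
  then have "\<exists>c>0. monomial_act t id ?e = c *\<^sub>R ?e"
    by (rule iffD1[OF hpt_eq_iff[OF e monomial_act_orthant[OF bij_id t(2) e]]])
  then obtain c where c: "c > 0" "monomial_act t id ?e = c *\<^sub>R ?e" by blast
  have avt: "av (t l) = c" for l using arg_cong[OF c(2), of "\<lambda>a. a $ l"] by simp
  obtain i :: 'n where True by simp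
  define s where "s = (\<lambda>l. t l / t i)"
  have s: "s l \<noteq> 0" "av (s l) = 1" for l using t(2) avt c(1) by (simp_all add: s_def av_divide)
  have "mono_mat t id = mat (t i) ** mono_mat s id"
    using t(2) by (simp add: vec_eq_iff s_def)
  then have "z = proj (mono_mat s id)"
    using t(2) s by (simp add: z proj_mat_mult invertible_mono_mat)
  moreover have S: "mono_mat s id \<in> biunit ?e ?e"
    using mono_mat_biunit[of id s ?e] s by simp
  ultimately have "g = proj (B ** mono_mat s id)"
    using B uz(3) by (simp add: proj_mult biunit_invertible)
  moreover have "B ** mono_mat s id \<in> biunit ?e ?e" using biunit_mult[OF B(1) S] by simp
  ultimately show ?thesis using that by blast
qed

section \<open>Determinants and pivots\<close>

lemma av_det_le:
  fixes A :: "'k^'n::finite^'n"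
  obtains p where "p permutes (UNIV :: 'n set)" "av (det A) \<le> (\<Prod>i\<in>UNIV. av (A $ i $ p i))"
proof -
  define P where "P = {p. p permutes (UNIV :: 'n set)}"
  define F where "F p = (\<Prod>i\<in>UNIV. av (A $ i $ p i))" for p
  have "id \<in> P" by (simp add: P_def)
  then have "P \<noteq> {}" by blast
  moreover have "finite P" by (simp add: P_def finite_permutations)
  ultimately have fin: "finite P" "P \<noteq> {}" by simp_all
  have "av (of_int (sign p) * (\<Prod>i\<in>UNIV. A $ i $ p i)) = F p" for p :: "'n \<Rightarrow> 'n"
    by (simp add: av_mult sign_def av_prod F_def)
  \<comment> \<open>By the Leibniz formula and the ultrametric inequality, the determinant is
    bounded by its largest term; signs have absolute value \<open>1\<close>.\<close>
  then have "av (det A) \<le> Max (F ` P)"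
    unfolding det_def P_def[symmetric] using fin
    by (intro av_sum_le) (auto simp: Max_ge_iff F_def prod_nonneg)
  moreover have "Max (F ` P) \<in> F ` P" using fin by (intro Max_in) auto
  ultimately show ?thesis using that unfolding P_def F_def by force
qed

text \<open>A term of the Leibniz expansion is bounded by the product of the ratios
  \<open>a $ i / a $ p i\<close>, which is \<open>1\<close> for a permutation \<open>p\<close>.
  Applied to the matrix and to its inverse, this gives two determinants of absolute value at most
  \<open>1\<close> with product \<open>1\<close>.\<close>

lemma biunit_av_det:
  fixes A :: "'k^'n::finite^'n"
  assumes a: "\<And>i. 0 < a $ i" and A: "A \<in> biunit a a"
  shows "av (det A) = 1"
proof -
  have le: "av (det M) \<le> 1" if M: "bounded_mat a a M" for M
  proof -
    obtain p where p: "p permutes (UNIV :: 'n set)" "av (det M) \<le> (\<Prod>i\<in>UNIV. av (M $ i $ p i))"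
      by (rule av_det_le)
    have "(\<Prod>i\<in>UNIV. av (M $ i $ p i)) \<le> (\<Prod>i\<in>UNIV. a $ i / a $ p i)"
      using M a by (intro prod_mono) (simp add: bounded_mat_def pos_le_divide_eq)
    also have "\<dots> = 1"
      using prod.permute[OF p(1), of "\<lambda>i. a $ i"] a by (simp add: prod_dividef o_def less_imp_neq[symmetric])
    finally show ?thesis using p(2) by simp
  qed
  obtain B where B: "A ** B = mat 1" "bounded_mat a a A" "bounded_mat a a B"
    using A by (auto simp: biunit_def)
  have "av (det A) * av (det B) = 1" using arg_cong[OF B(1), of det] by (simp add: det_mul flip: av_mult)
  then show ?thesis using le[OF B(2)] le[OF B(3)] mult_le_one[of "av (det A)" "av (det B)"]
    by (metis av_nonneg antisym mult.right_neutral mult_left_mono)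
qed

text \<open>Take a dominating term of the Leibniz expansion. Its relative sizes \<open>f i\<close>
  are at most \<open>1\<close>, and their product is at least the absolute value of the determinant,
  which is \<open>1\<close>; so each of them equals \<open>1\<close>.\<close>

lemma biunit_pivots:
  fixes A :: "'k^'n::finite^'n"
  assumes a: "\<And>i. 0 < a $ i" and A: "A \<in> biunit a a"
  obtains p where "bij p" "\<And>i. av (A $ i $ p i) * a $ p i = a $ i"
proof -
  obtain p where p: "p permutes (UNIV :: 'n set)" "av (det A) \<le> (\<Prod>i\<in>UNIV. av (A $ i $ p i))"
    by (rule av_det_le)
  define f where "f i = av (A $ i $ p i) * a $ p i / a $ i" for i
  have f: "0 \<le> f i" "f i \<le> 1" for i
    using A a less_imp_le[OF a] by (auto simp: f_def biunit_def bounded_mat_def)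
  have "(\<Prod>i\<in>UNIV. f i) = (\<Prod>i\<in>UNIV. av (A $ i $ p i))"
    using prod.permute[OF p(1), of "\<lambda>i. a $ i"] a
    by (simp add: f_def prod_dividef prod.distrib o_def less_imp_neq[symmetric])
  then have ge: "1 \<le> (\<Prod>i\<in>UNIV. f i)" using p(2) biunit_av_det[OF a A] by simp
  have f1: "f i = 1" for i
  proof -
    have "(\<Prod>i\<in>UNIV. f i) = f i * (\<Prod>j\<in>UNIV - {i}. f j)" by (rule prod.remove) auto
    also have "\<dots> \<le> f i * 1" using f by (intro mult_left_mono prod_le_1) auto
    finally show ?thesis using ge f(2)[of i] by simp
  qed
  have "av (A $ i $ p i) * a $ p i = a $ i" for i
    using f1[of i] unfolding f_def divide_eq_1_iff by blast
  then show ?thesis using that permutes_bij[OF p(1)] by blast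
qed

section \<open>Gaussian elimination\<close>

definition col_mat :: "'n::finite \<Rightarrow> 'n set \<Rightarrow> ('n \<Rightarrow> 'k) \<Rightarrow> 'k^'n^'n" where
  "col_mat r R c = (\<chi> k l. if k = l then 1 else if l = r \<and> k \<in> R then c k else 0)"

lemma col_mat_mult_nth:
  assumes "r \<notin> R"
  shows "(col_mat r R c ** A) $ k $ l = A $ k $ l + (if k \<in> R then c k * A $ r $ l else 0)"
proof -
  have "(col_mat r R c ** A) $ k $ l = (\<Sum>m\<in>UNIV. (if m = k then A $ m $ l else 0)
      + (if m = r then (if k \<in> R then c k * A $ m $ l else 0) else 0))"
    unfolding matrix_matrix_mult_def col_mat_def vec_lambda_beta using assms
    by (intro sum.cong refl) auto
  then show ?thesis by (simp add: sum.distrib)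
qed

text \<open>For \<open>r \<notin> R\<close> the matrix is the product of the elementary matrices
  \<open>elem_mat k r (c k)\<close> with \<open>k \<in> R\<close>, each of which lies in a root
  group at the point.\<close>

lemma col_mat_biunit_U_pt:
  fixes a :: "real^'n::finite"
  assumes a: "a \<in> orthant" and R: "r \<notin> R" "\<And>k. k \<in> R \<Longrightarrow> av (c k) * a $ r \<le> a $ k"
  shows "col_mat r R c \<in> biunit a a \<and> proj (col_mat r R c) \<in> U_pt v (hpt a)"
proof -
  have nn: "0 \<le> a $ i" for i using a by (simp add: orthant_def)
  interpret U: subgroup "U_pt v (hpt a)" "PGL :: ('k^'n^'n) set monoid"
    by (rule U_pt_subgroup) (rule hpt_in_cpt_apartment[OF a])
  have "finite R" by simp
  then show ?thesis using R
  proof (induction R)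
    case empty
    have "col_mat r {} c = mat 1" by (simp add: vec_eq_iff col_mat_def mat_def)
    then show ?case using mat_1_biunit[OF nn] U.one_closed by (simp add: one_PGL)
  next
    case (insert k R)
    then have kr: "k \<noteq> r" by auto
    have "col_mat r (insert k R) c = elem_mat k r (c k) ** col_mat r R c"
      using insert.hyps insert.prems(1) by (auto simp: vec_eq_iff elem_mat_mult_nth[OF kr] col_mat_def)
    moreover have E: "elem_mat k r (c k) \<in> biunit a a"
      using insert.prems(2) by (intro elem_mat_biunit[OF nn kr]) simp
    moreover have "proj (elem_mat k r (c k)) \<in> U_pt v (hpt a)"
      unfolding U_pt_hpt[OF a] root_elems_def
      using kr insert.prems(2) by (intro generate.incl) blast
    moreover have "col_mat r R c \<in> biunit a a" "proj (col_mat r R c) \<in> U_pt v (hpt a)"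
      using insert by auto
    ultimately show ?case using biunit_mult[OF _ _ nn nn]
      by (metis biunit_invertible proj_mult U.m_closed)
  qed
qed

text \<open>\<open>C\<close> is the set of columns already reduced to at most one nonzero entry.
  Pivots are computed anew for the current matrix; since the pivot of column \<open>j\<close> has
  maximal relative size, the row operations clearing that column belong to \<open>U_x\<close>, and
  they leave the columns in \<open>C\<close> alone.\<close>

lemma biunit_eliminate:
  fixes A :: "'k^'n::finite^'n"
  assumes a: "\<And>i. 0 < a $ i" and A: "A \<in> biunit a a"
  shows "\<exists>u \<in> U_pt v (hpt a). \<exists>B \<in> biunit a a. proj A = u \<otimes>\<^bsub>PGL\<^esub> proj B \<and>
    (\<forall>j\<in>C. \<exists>i. \<forall>k. k \<noteq> i \<longrightarrow> B $ k $ j = 0)"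
proof -
  have nn: "0 \<le> a $ i" for i using a less_imp_le by blast
  have "a \<noteq> 0" using a by (metis less_irrefl zero_index)
  then have ao: "a \<in> orthant" using nn by (simp add: orthant_def)
  interpret group "PGL :: ('k^'n^'n) set monoid" by (rule group_PGL)
  interpret U: subgroup "U_pt v (hpt a)" "PGL :: ('k^'n^'n) set monoid"
    by (rule U_pt_subgroup) (rule hpt_in_cpt_apartment[OF ao])
  have "finite C" by simp
  then show ?thesis
  proof (induction C)
    case empty
    show ?case using A U.one_closed biunit_invertible[OF A]
      by (intro bexI[of _ "\<one>\<^bsub>PGL\<^esub>"] bexI[of _ A]) auto
  next
    case (insert j C)
    then obtain u B where u: "u \<in> U_pt v (hpt a)" and B: "B \<in> biunit a a"
      and uB: "proj A = u \<otimes>\<^bsub>PGL\<^esub> proj B" and C: "\<forall>j\<in>C. \<exists>i. \<forall>k. k \<noteq> i \<longrightarrow> B $ k $ j = 0" by blast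
    obtain p where p: "bij p" "\<And>i. av (B $ i $ p i) * a $ p i = a $ i"
      using biunit_pivots[OF a B] by blast
    have piv: "B $ i $ p i \<noteq> 0" for i using p(2)[of i] a[of i] by auto
    obtain r where r: "p r = j" using p(1) by (metis bij_pointE)
    define c where "c k = - (B $ k $ j / B $ r $ j)" for k
    \<comment> \<open>The pivot attains equality in its bound, so a quotient of two entries of
      column \<open>j\<close> meets the bound for the root group.\<close>
    have "av (c k) * a $ r \<le> a $ k" for k
    proof -
      have "av (c k) * a $ r = av (B $ k $ j) * a $ j"
        using p(2)[of r] piv[of r] r by (simp add: c_def av_divide field_simps)
      then show ?thesis using B by (auto simp: biunit_def bounded_mat_def)
    qed
    then have E: "col_mat r (UNIV - {r}) c \<in> biunit a a" "proj (col_mat r (UNIV - {r}) c) \<in> U_pt v (hpt a)"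
      using col_mat_biunit_U_pt[OF ao, of r "UNIV - {r}" c] by auto
    define B' where "B' = col_mat r (UNIV - {r}) c ** B"
    have B'_nth: "B' $ k $ l = B $ k $ l + (if k \<noteq> r then c k * B $ r $ l else 0)" for k l
      by (simp add: B'_def col_mat_mult_nth)
    have "proj B' = proj (col_mat r (UNIV - {r}) c) \<otimes>\<^bsub>PGL\<^esub> proj B"
      using B E by (simp add: B'_def proj_mult biunit_invertible)
    then have "proj B = inv\<^bsub>PGL\<^esub> (proj (col_mat r (UNIV - {r}) c)) \<otimes>\<^bsub>PGL\<^esub> proj B'"
      using B E by (simp add: biunit_invertible inv_mult_cancel_left)
    then have "proj A = (u \<otimes>\<^bsub>PGL\<^esub> inv\<^bsub>PGL\<^esub> (proj (col_mat r (UNIV - {r}) c))) \<otimes>\<^bsub>PGL\<^esub> proj B'"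
      using u E B biunit_mult[OF E(1) B nn nn] by (simp add: uB m_assoc biunit_invertible B'_def)
    moreover have "B' \<in> biunit a a" unfolding B'_def by (rule biunit_mult[OF E(1) B nn nn])
    moreover have "\<forall>l\<in>insert j C. \<exists>i. \<forall>k. k \<noteq> i \<longrightarrow> B' $ k $ l = 0"
    proof
      fix l assume l: "l \<in> insert j C"
      have rj: "B $ r $ j \<noteq> 0" using piv[of r] r by simp
      show "\<exists>i. \<forall>k. k \<noteq> i \<longrightarrow> B' $ k $ l = 0"
      proof (cases "l = j")
        case True
        then show ?thesis using rj by (intro exI[of _ r]) (simp add: B'_nth c_def)
      next
        case False
        then obtain i where i: "\<forall>k. k \<noteq> i \<longrightarrow> B $ k $ l = 0" using l C by blast
        \<comment> \<open>The single nonzero entry of column \<open>l\<close> is its pivot, in a row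
          other than \<open>r\<close>; hence row \<open>r\<close> has \<open>0\<close> in column
          \<open>l\<close>, and adding multiples of it changes nothing there.\<close>
        obtain r' where r': "p r' = l" using p(1) by (metis bij_pointE)
        then have "r' = i" using i piv[of r'] by metis
        then have "r \<noteq> i" using r r' False by auto
        then show ?thesis using i by (intro exI[of _ i]) (simp add: B'_nth)
      qed
    qed
    ultimately show ?case using u E(2) by (meson U.m_closed U.m_inv_closed)
  qed
qed

text \<open>Once every column has at most one nonzero entry, the matrix is monomial with its entries
  at the pivots. The pivot equalities say precisely that it preserves the coordinates
  \<open>a\<close>, hence lies in \<open>N_x\<close>.\<close>

proposition biunit_in_P_pt:
  fixes A :: "'k^'n::finite^'n"
  assumes a: "\<And>i. 0 < a $ i" and A: "A \<in> biunit a a"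
  shows "proj A \<in> P_pt v (hpt a)"
proof -
  interpret group "PGL :: ('k^'n^'n) set monoid" by (rule group_PGL)
  obtain u B where u: "u \<in> U_pt v (hpt a)" and B: "B \<in> biunit a a"
    and uB: "proj A = u \<otimes>\<^bsub>PGL\<^esub> proj B" and col: "\<And>j. \<exists>i. \<forall>k. k \<noteq> i \<longrightarrow> B $ k $ j = 0"
    using biunit_eliminate[OF a A, of UNIV] by blast
  obtain p where p: "bij p" "\<And>i. av (B $ i $ p i) * a $ p i = a $ i"
    using biunit_pivots[OF a B] by blast
  have piv: "B $ i $ p i \<noteq> 0" for i using p(2)[of i] a[of i] by auto
  have zero: "B $ k $ p i = 0" if "k \<noteq> i" for k i
    using col[of "p i"] piv[of i] that by metis
  \<comment> \<open>\<open>p\<close> leads from rows to columns, whereas \<open>mono_mat\<close>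
    wants the map from columns to rows.\<close>
  define w where "w = inv_into UNIV p"
  have w: "bij w" "inv_into UNIV w = p" using p(1) by (simp_all add: w_def bij_imp_bij_inv inv_inv_eq)
  have wp: "w (p i) = i" "p (w i) = i" for i
    using p(1) by (simp_all add: w_def bij_is_inj bij_is_surj surj_f_inv_f)
  have "B $ k $ l = (if k = w l then B $ k $ p k else 0)" for k l
    using zero[of k "w l"] wp by auto
  then have "B = mono_mat (\<lambda>i. B $ i $ p i) w" 
    unfolding vec_eq_iff mono_mat_nth by blast
  moreover have "monomial_act (\<lambda>i. B $ i $ p i) w a = a"
    using p(2) by (simp add: vec_eq_iff w)
  ultimately have "nu v (proj B) (hpt a) = hpt a" "proj B \<in> monomial_group"
    using nu_mono_mat[of w "\<lambda>i. B $ i $ p i" a] mono_mat_in_monomial_group[of w "\<lambda>i. B $ i $ p i"] w piv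
    by simp_all
  then show ?thesis unfolding P_pt_def uB by (intro set_mult_memI u) (simp add: N_pt_def)
qed

section \<open>Truncation and the equivalence of pairs\<close>

text \<open>This replaces the geodesic convexity of the set of fixed points of a subgroup.\<close>

lemma bounded_mat_truncate:
  assumes "bounded_mat a b A" "bounded_mat (\<chi> i. 1) (\<chi> i. 1) A" "0 \<le> s"
  shows "bounded_mat (\<chi> i. max (a $ i) s) (\<chi> i. max (b $ i) s) A"
  unfolding bounded_mat_def
proof (intro allI)
  fix i j
  have "av (A $ i $ j) * s \<le> s" using assms(2,3) by (simp add: bounded_mat_def mult_left_le_one_le)
  moreover have "av (A $ i $ j) * b $ j \<le> a $ i" using assms(1) by (simp add: bounded_mat_def)
  ultimately show "av (A $ i $ j) * (\<chi> i. max (b $ i) s) $ j \<le> (\<chi> i. max (a $ i) s) $ i"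
    by (auto simp: max_def)
qed

proposition truncation_compatible:
  fixes A :: "'k^'n::finite^'n"
  assumes A: "A \<in> biunit (\<chi> i. 1) (\<chi> i. 1)" and a: "a \<in> cube_face"
    and n: "n \<in> monomial_group" "proj A \<otimes>\<^bsub>PGL\<^esub> n \<in> P_pt v (hpt a)" and s: "0 < s"
  obtains b m where "b \<in> cube_face" "nu v n (hpt a) = hpt b" "m \<in> monomial_group"
    "nu v m (hpt (\<chi> i. max (a $ i) s)) = hpt (\<chi> i. max (b $ i) s)"
    "proj A \<otimes>\<^bsub>PGL\<^esub> m \<in> P_pt v (hpt (\<chi> i. max (a $ i) s))"
proof -
  interpret group "PGL :: ('k^'n^'n) set monoid" by (rule group_PGL)
  interpret N: subgroup monomial_group "PGL :: ('k^'n^'n) set monoid" by (rule monomial_group_subgroup)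
  have ao: "a \<in> orthant" using a by (rule cube_face_orthant)
  have nn: "0 \<le> a $ i" for i using ao by (simp add: orthant_def)
  have cpt: "hpt a \<in> cpt_apartment" using ao by (rule hpt_in_cpt_apartment)
  obtain u m where um: "u \<in> U_pt v (hpt a)" "m \<in> N_pt v (hpt a)" "proj A \<otimes>\<^bsub>PGL\<^esub> n = u \<otimes>\<^bsub>PGL\<^esub> m"
    using n(2) unfolding P_pt_def by (rule set_mult_memE)
  have m: "m \<in> monomial_group" "nu v (inv\<^bsub>PGL\<^esub> m) (hpt a) = hpt a"
    using um(2) nu_inv[of m "hpt a"] cpt by (auto simp: N_pt_def)
  \<comment> \<open>The factor in \<open>N_x\<close> is moved to the monomial side:
    \<open>n'\<close> sends \<open>hpt a\<close> to the same point as \<open>n\<close>, and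
    \<open>proj A\<close> times \<open>n'\<close> lies in \<open>U_x\<close>.\<close>
  define n' where "n' = n \<otimes>\<^bsub>PGL\<^esub> inv\<^bsub>PGL\<^esub> m"
  have n': "n' \<in> monomial_group" "nu v n' (hpt a) = nu v n (hpt a)"
    using n(1) m cpt by (simp_all add: n'_def nu_mult)
  have uc: "u \<in> carrier PGL" using um(1) subgroup.mem_carrier[OF U_pt_subgroup[OF cpt]] by blast
  have iA: "invertible A" using A by (rule biunit_invertible)
  have Au: "proj A \<otimes>\<^bsub>PGL\<^esub> n' = u"
  proof -
    have "proj A \<otimes>\<^bsub>PGL\<^esub> n' = (proj A \<otimes>\<^bsub>PGL\<^esub> n) \<otimes>\<^bsub>PGL\<^esub> inv\<^bsub>PGL\<^esub> m"
      using n(1) m(1) iA by (simp add: n'_def m_assoc)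
    then show ?thesis using um(3) uc m(1) by (simp add: m_assoc)
  qed
  obtain t w where tw: "n' = proj (mono_mat t w)" "\<And>i. t i \<noteq> 0" "bij w"
    using n'(1) by (auto simp: monomial_group_eq)
  obtain B where B: "B \<in> biunit a a" "u = proj B" using U_pt_biunit[OF ao um(1)] by blast
  have "proj (A ** mono_mat t w) = proj B"
    using Au B(2) tw iA by (simp add: proj_mult invertible_mono_mat)
  then obtain c where c: "c \<noteq> 0" "B = mat c ** (A ** mono_mat t w)"
    using proj_eq_iff iA invertible_mono_mat tw invertible_mult biunit_invertible[OF B(1)] by metis
  \<comment> \<open>The scalar left open by \<open>proj\<close> is put into the torus part. Then
    \<open>B = A ** D\<close> holds for matrices, which also singles out the representative
    \<open>b\<close> of the second point.\<close>
  define t' where "t' = (\<lambda>l. c * t l)"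
  have t': "t' l \<noteq> 0" for l using tw(2) c(1) by (simp add: t'_def)
  define D where "D = mono_mat t' w"
  have Dc: "D = mat c ** mono_mat t w" by (simp add: D_def vec_eq_iff t'_def)
  then have BAD: "B = A ** D"
    using c(2) by (metis matrix_mul_assoc mat_mult_commute)
  define b where "b = monomial_act t' w a"
  have nub: "nu v n (hpt a) = hpt b"
  proof -
    have "proj D = proj (mono_mat t w)"
      using c(1) tw Dc by (simp add: proj_mat_mult invertible_mono_mat)
    then show ?thesis using nu_mono_mat[OF tw(3), of t' a] t' n'(2) tw(1) by (simp add: b_def D_def)
  qed
  have nnb: "0 \<le> b $ i" for i using nn by (simp add: b_def)
  have D: "D \<in> biunit b a" unfolding D_def b_def by (rule mono_mat_biunit[OF tw(3) t' nn])
  obtain D' where D': "D ** D' = mat 1" "D' ** D = mat 1" using D by (auto simp: biunit_def)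
  have "A = B ** D'" by (simp add: BAD D'(1) flip: matrix_mul_assoc)
  then have Aab: "A \<in> biunit a b"
    using biunit_mult[OF B(1) biunit_inverse[OF D D'] nn nnb] by simp
  obtain A' where A': "A ** A' = mat 1" "A' ** A = mat 1" using A by (auto simp: biunit_def)
  have A'ba: "A' \<in> biunit b a" using Aab A' by (rule biunit_inverse)
  have A'1: "A' \<in> biunit (\<chi> i. 1) (\<chi> i. 1)" using A A' by (rule biunit_inverse)
  \<comment> \<open>With all weights \<open>1\<close>, pivots are entries of absolute value
    \<open>1\<close>; at these entries the inequalities between \<open>a\<close> and
    \<open>b\<close> become plain bounds on coordinates.\<close>
  obtain p where p: "bij p" "\<And>i. av (A $ i $ p i) = 1"
    using biunit_pivots[OF _ A] by auto
  obtain q where q: "bij q" "\<And>i. av (A' $ i $ q i) = 1"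
    using biunit_pivots[OF _ A'1] by auto
  have bp: "b $ p i \<le> a $ i" for i
  proof -
    have "av (A $ i $ p i) * b $ p i \<le> a $ i" using Aab by (auto simp: biunit_def bounded_mat_def)
    then show ?thesis by (simp add: p)
  qed
  have aq: "a $ q i \<le> b $ i" for i
  proof -
    have "av (A' $ i $ q i) * a $ q i \<le> b $ i" using A'ba by (auto simp: biunit_def bounded_mat_def)
    then show ?thesis by (simp add: q)
  qed
  \<comment> \<open>The two families of bounds add up to inequalities between the total sums in
    opposite directions; so the sums agree, and then the summands agree one by one.\<close>
  have "(\<Sum>i\<in>UNIV. b $ p i) = (\<Sum>i\<in>UNIV. b $ i)" "(\<Sum>i\<in>UNIV. a $ q i) = (\<Sum>i\<in>UNIV. a $ i)"
    using sum.reindex_bij_betw[of p UNIV UNIV "\<lambda>i. b $ i"] sum.reindex_bij_betw[of q UNIV UNIV "\<lambda>i. a $ i"] p(1) q(1)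
    by simp_all
  moreover have "(\<Sum>i\<in>UNIV. a $ q i) \<le> (\<Sum>i\<in>UNIV. b $ i)" using aq by (intro sum_mono)
  moreover have "(\<Sum>i\<in>UNIV. b $ p i) \<le> (\<Sum>i\<in>UNIV. a $ i)" using bp by (intro sum_mono)
  ultimately have eq: "(\<Sum>i\<in>UNIV. b $ p i) = (\<Sum>i\<in>UNIV. a $ i)" by linarith
  have ba: "b $ p i = a $ i" for i
    by (rule sum_mono_inv[OF eq]) (use bp in auto)
  have bl: "b $ l = a $ inv_into UNIV p l" for l
    using ba[of "inv_into UNIV p l"] p(1) by (simp add: bij_is_surj surj_f_inv_f)
  have bcf: "b \<in> cube_face"
  proof -
    obtain i where "a $ i = 1" using a by (auto simp: cube_face_iff)
    then have "b $ p i = 1" by (simp add: ba)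
    moreover have "0 \<le> b $ l \<and> b $ l \<le> 1" for l using a by (simp add: bl cube_face_iff)
    ultimately show ?thesis unfolding cube_face_iff by blast
  qed
  define a' where "a' = (\<chi> i. max (a $ i) s)"
  define b' where "b' = (\<chi> i. max (b $ i) s)"
  have pos: "0 < a' $ i" "0 < b' $ i" for i using s by (auto simp: a'_def b'_def less_max_iff_disj)
  have Aab': "A \<in> biunit a' b'"
  proof -
    have "bounded_mat (\<chi> i. 1) (\<chi> i. 1) A" "bounded_mat (\<chi> i. 1) (\<chi> i. 1) A'" "bounded_mat a b A" "bounded_mat b a A'"
      using A A'1 Aab A'ba by (auto simp: biunit_def)
    then have "bounded_mat a' b' A" "bounded_mat b' a' A'"
      unfolding a'_def b'_def using s by (simp_all add: bounded_mat_truncate)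
    then show ?thesis using A' by (auto simp: biunit_def)
  qed
  \<comment> \<open>The permutation matrix of \<open>p\<close> replaces \<open>n\<close> as the
    witness; permuting coordinates commutes with taking the maximum with \<open>s\<close>.\<close>
  define Q :: "'k^'n^'n" where "Q = mono_mat (\<lambda>_. 1) p"
  have act: "monomial_act (\<lambda>_. 1) p a' = b'" by (simp add: vec_eq_iff a'_def b'_def bl)
  have Q: "Q \<in> biunit b' a'"
    using mono_mat_biunit[OF p(1), of "\<lambda>_. 1" a'] less_imp_le[OF pos(1)]
    unfolding act Q_def by simp
  have "A ** Q \<in> biunit a' a'"
    using biunit_mult[OF Aab' Q] less_imp_le[OF pos(1)] by simp
  then have "proj (A ** Q) \<in> P_pt v (hpt a')" using pos(1) by (intro biunit_in_P_pt)
  then have "proj A \<otimes>\<^bsub>PGL\<^esub> proj Q \<in> P_pt v (hpt a')"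
    using iA biunit_invertible[OF Q] by (simp add: proj_mult)
  moreover have "proj Q \<in> monomial_group"
    unfolding Q_def using p(1) by (intro mono_mat_in_monomial_group) auto
  moreover have "nu v (proj Q) (hpt a') = hpt b'"
    using nu_mono_mat[OF p(1), of "\<lambda>_. 1" a'] unfolding act Q_def by simp
  ultimately show ?thesis using that[OF bcf nub] unfolding a'_def b'_def by blast
qed

end

section \<open>The contraction\<close>

definition hcoord :: "'n::finite apt_point \<Rightarrow> real^'n" where
  "hcoord = inv_into cube_face hpt"

lemma hcoord_hpt [simp]: "a \<in> cube_face \<Longrightarrow> hcoord (hpt a) = a"
  unfolding hcoord_def by (rule inv_into_f_f[OF inj_on_hpt])

lemma hcoord_cube_face: "z \<in> cpt_apartment \<Longrightarrow> hcoord z \<in> cube_face"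
  unfolding hcoord_def by (rule inv_into_into) (simp add: hpt_cube_face)

lemma hpt_hcoord [simp]: "z \<in> cpt_apartment \<Longrightarrow> hpt (hcoord z) = z"
  unfolding hcoord_def by (rule f_inv_into_f) (simp add: hpt_cube_face)

lemma continuous_map_hcoord:
  "continuous_map (cpt_apartment_topology :: 'n::finite apt_point topology) (top_of_set cube_face) hcoord"
proof -
  obtain f :: "'n apt_point \<Rightarrow> real^'n"
    where f: "homeomorphic_maps (top_of_set cube_face) cpt_apartment_topology hpt f"
    using homeomorphic_map_hpt homeomorphic_map_maps by blast
  then have c: "continuous_map cpt_apartment_topology (top_of_set cube_face) f"
    by (simp add: homeomorphic_maps_def)
  show ?thesis
  proof (rule continuous_map_eq[OF c])
    fix z :: "'n apt_point" assume "z \<in> topspace cpt_apartment_topology"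
    then have "z = hpt (hcoord z)" "hcoord z \<in> cube_face" by (simp_all add: hcoord_cube_face)
    then show "f z = hcoord z" using f by (metis homeomorphic_maps_def topspace_euclidean_subtopology)
  qed
qed

definition squeeze :: "real \<Rightarrow> 'n::finite apt_point \<Rightarrow> 'n apt_point" where
  "squeeze s z = hpt (\<chi> i. max (hcoord z $ i) s)"

lemma squeeze_hpt: "a \<in> cube_face \<Longrightarrow> squeeze s (hpt a) = hpt (\<chi> i. max (a $ i) s)"
  by (simp add: squeeze_def)

lemma truncate_cube_face:
  assumes "a \<in> cube_face" "s \<in> {0..1}"
  shows "(\<chi> i. max (a $ i) s) \<in> cube_face"
proof -
  obtain i where "a $ i = 1" using assms(1) by (auto simp: cube_face_iff)
  then have "(\<chi> i. max (a $ i) s) $ i = 1" using assms(2) by simp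
  then show ?thesis using assms unfolding cube_face_iff by (auto intro: max.coboundedI1)
qed

lemma squeeze_closed: "z \<in> cpt_apartment \<Longrightarrow> s \<in> {0..1} \<Longrightarrow> squeeze s z \<in> cpt_apartment"
  unfolding squeeze_def
  by (intro hpt_in_cpt_apartment cube_face_orthant truncate_cube_face hcoord_cube_face)

lemma squeeze_0: "z \<in> cpt_apartment \<Longrightarrow> squeeze 0 z = z"
proof -
  assume z: "z \<in> cpt_apartment"
  then have "(\<chi> i. max (hcoord z $ i) 0) = hcoord z"
    using hcoord_cube_face[OF z] by (auto simp: vec_eq_iff cube_face_iff intro: max_absorb1)
  then show ?thesis using z by (simp add: squeeze_def)
qed

lemma squeeze_1: "z \<in> cpt_apartment \<Longrightarrow> squeeze 1 z = hpt (\<chi> i. 1)"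
proof -
  assume z: "z \<in> cpt_apartment"
  then have "(\<chi> i. max (hcoord z $ i) 1) = (\<chi> i. 1)"
    using hcoord_cube_face[OF z] by (auto simp: vec_eq_iff cube_face_iff intro: max_absorb2)
  then show ?thesis by (simp add: squeeze_def)
qed

lemma continuous_map_squeeze:
  "continuous_map (prod_topology (top_of_set {0..1}) cpt_apartment_topology)
     (cpt_apartment_topology :: 'n::finite apt_point topology) (\<lambda>x. squeeze (fst x) (snd x))"
proof -
  let ?P = "prod_topology (top_of_set {0..1::real}) (cpt_apartment_topology :: 'n apt_point topology)"
  have fst: "continuous_map ?P (top_of_set {0..1}) fst"
    by (rule continuous_map_fst)
  have coord: "continuous_map ?P (top_of_set cube_face) (\<lambda>x. hcoord (snd x))"
    using continuous_map_compose[OF continuous_map_snd continuous_map_hcoord] by (simp add: o_def)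
  have pair: "continuous_map ?P (prod_topology euclidean euclidean) (\<lambda>x. (fst x, hcoord (snd x)))"
    using fst coord by (intro continuous_map_pairedI) (simp_all add: continuous_map_in_subtopology)
  have "continuous_on UNIV (\<lambda>x :: real \<times> (real^'n). \<chi> i. max (snd x $ i) (fst x))"
    by (intro continuous_on_vec_lambda continuous_intros)
  then have "continuous_map (prod_topology euclidean euclidean) euclidean
      (\<lambda>x :: real \<times> (real^'n). \<chi> i. max (snd x $ i) (fst x))"
    by simp
  from continuous_map_compose[OF pair this]
  have "continuous_map ?P euclidean (\<lambda>x. \<chi> i. max (hcoord (snd x) $ i) (fst x))"
    by (simp add: o_def)
  moreover have "(\<chi> i. max (hcoord (snd x) $ i) (fst x)) \<in> cube_face" if "x \<in> topspace ?P" for x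
    using that by (auto intro!: truncate_cube_face hcoord_cube_face)
  ultimately have "continuous_map ?P (top_of_set cube_face) (\<lambda>x. \<chi> i. max (hcoord (snd x) $ i) (fst x))"
    by (simp add: continuous_map_in_subtopology image_subset_iff)
  from continuous_map_compose[OF this homeomorphic_imp_continuous_map[OF homeomorphic_map_hpt]]
  show ?thesis by (simp add: o_def squeeze_def)
qed

section \<open>Descent to the quotient\<close>

context valued_field begin

lemma building_rel_squeeze:
  assumes gh: "((g, x), (h, y)) \<in> building_rel v" and s: "s \<in> {0..1}"
  shows "((g, squeeze s x), (h, squeeze s y)) \<in> building_rel v"
\<comment> \<open>Truncation at \<open>s > 0\<close> makes all coordinates positive, as the
  membership criterion for \<open>P_x\<close> requires; at \<open>s = 0\<close> nothing
  moves.\<close>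
proof (cases "s = 0")
  case True
  then show ?thesis using gh by (auto simp: building_rel_def squeeze_0)
next
  case False
  interpret group "PGL :: ('k^'n^'n) set monoid" by (rule group_PGL)
  have s0: "0 < s" using s False by simp
  obtain n where g: "g \<in> U0_hat v" and x: "x \<in> cpt_apartment" and h: "h \<in> U0_hat v"
    and y: "y \<in> cpt_apartment" and n: "n \<in> monomial_group" "nu v n x = y"
    and P: "inv\<^bsub>PGL\<^esub> g \<otimes>\<^bsub>PGL\<^esub> h \<otimes>\<^bsub>PGL\<^esub> n \<in> P_pt v x"
    using gh unfolding building_rel_def by blast
  obtain a where a: "a \<in> cube_face" "x = hpt a" using x hpt_cube_face by blast
  obtain B where B: "B \<in> biunit (\<chi> i. 1) (\<chi> i. 1)" "g = proj B" using U0_hat_biunit[OF g] .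
  obtain C where C: "C \<in> biunit (\<chi> i. 1) (\<chi> i. 1)" "h = proj C" using U0_hat_biunit[OF h] .
  obtain B' where B': "B ** B' = mat 1" "B' ** B = mat 1" using B(1) by (auto simp: biunit_def)
  have B'1: "B' \<in> biunit (\<chi> i. 1) (\<chi> i. 1)" using B(1) B' by (rule biunit_inverse)
  have A: "B' ** C \<in> biunit (\<chi> i. 1) (\<chi> i. 1)" using biunit_mult[OF B'1 C(1)] by simp
  have gh: "inv\<^bsub>PGL\<^esub> g \<otimes>\<^bsub>PGL\<^esub> h = proj (B' ** C)"
    using inv_proj[OF B'] B'1 B(2) C by (simp add: proj_mult biunit_invertible)
  obtain b m where "b \<in> cube_face" "nu v n (hpt a) = hpt b" "m \<in> monomial_group"
    "nu v m (hpt (\<chi> i. max (a $ i) s)) = hpt (\<chi> i. max (b $ i) s)"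
    "proj (B' ** C) \<otimes>\<^bsub>PGL\<^esub> m \<in> P_pt v (hpt (\<chi> i. max (a $ i) s))"
    using truncation_compatible[OF A a(1) n(1) _ s0] P unfolding gh a(2) by metis
  moreover have "y = hpt b" using n(2) a(2) calculation(2) by simp
  ultimately show ?thesis
    using g h x y s unfolding building_rel_def
    by (auto simp: gh a squeeze_hpt intro!: squeeze_closed bexI[of _ m] simp flip: squeeze_hpt)
qed

text \<open>Invertible integral matrices belong to \<open>P_x\<close> at the origin, so all pairs
  over the origin lie in one class, the endpoint of the contraction.\<close>

lemma building_rel_origin:
  assumes "g \<in> U0_hat v" "h \<in> U0_hat v"
  shows "((g, hpt (\<chi> i. 1)), (h, hpt (\<chi> i. 1))) \<in> (building_rel v :: ((('k^'n::finite^'n) set \<times> 'n apt_point) \<times> _) set)"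
proof -
  interpret group "PGL :: ('k^'n^'n) set monoid" by (rule group_PGL)
  interpret N: subgroup monomial_group "PGL :: ('k^'n^'n) set monoid" by (rule monomial_group_subgroup)
  let ?o = "hpt (\<chi> i. 1) :: 'n apt_point"
  have o: "?o \<in> cpt_apartment" using pt_0_cpt by (simp add: pt_0)
  interpret P: subgroup "P_pt v ?o" "PGL :: ('k^'n^'n) set monoid" using o by (rule P_pt_subgroup)
  have "g \<in> P_pt v ?o" if g: "g \<in> U0_hat v" for g
  proof -
    obtain B where B: "B \<in> biunit (\<chi> i. 1) (\<chi> i. 1)" "g = proj B" using U0_hat_biunit[OF g] .
    then show ?thesis using biunit_in_P_pt[OF _ B(1)] by simp
  qed
  then have "inv\<^bsub>PGL\<^esub> g \<otimes>\<^bsub>PGL\<^esub> h \<otimes>\<^bsub>PGL\<^esub> \<one>\<^bsub>PGL\<^esub> \<in> P_pt v ?o" using assms by simp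
  then show ?thesis using assms o nu_one[OF o] unfolding building_rel_def
    by (auto intro!: bexI[of _ "\<one>\<^bsub>PGL\<^esub>"])
qed

proposition contractible_compactified_building:
  "contractible_space (compactified_building v :: (('k^'n::finite^'n) set \<times> 'n apt_point) set topology)"
proof -
  let ?G = "subtopology (PGL_topology v) (U0_hat v) :: ('k^'n^'n) set topology"
  let ?A = "cpt_apartment_topology :: 'n apt_point topology"
  let ?I = "top_of_set {0..1::real}"
  let ?X = "compactified_building v :: (('k^'n^'n) set \<times> 'n apt_point) set topology"
  let ?R = "building_rel v :: ((('k^'n^'n) set \<times> 'n apt_point) \<times> _) set"
  define q where "q a = ?R `` {a}" for a
  have q: "quotient_map (prod_topology ?G ?A) ?X q"
    unfolding compactified_building_def q_def by (rule quotient_map_quotient_topology)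
  have top: "fst a \<in> U0_hat v" "snd a \<in> cpt_apartment" if "a \<in> topspace (prod_topology ?G ?A)" for a
    using that by auto
  have q_eq: "q a = q b \<longleftrightarrow> (a, b) \<in> ?R"
    if "a \<in> U0_hat v \<times> cpt_apartment" "b \<in> U0_hat v \<times> cpt_apartment" for a b
    unfolding q_def using eq_equiv_class_iff[OF equiv_building_rel] that by blast
  define Q where "Q = (\<lambda>(s :: real, a). (s, q a))"
  have Q: "quotient_map (prod_topology ?I (prod_topology ?G ?A)) (prod_topology ?I ?X) Q"
    unfolding Q_def
  proof (rule quotient_map_prod_right[OF _ _ q])
    have "compact_space ?I" by (simp add: compact_space_subtopology)
    moreover have "Hausdorff_space ?I" by (simp add: Hausdorff_space_subtopology)
    ultimately show "locally_compact_space ?I" "Hausdorff_space ?I \<or> regular_space ?I"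
      by (simp_all add: compact_imp_locally_compact_space)
  qed
  \<comment> \<open>Only the point moves. The group component stays fixed throughout, and at level
    \<open>1\<close> it is forgotten by the identification over the origin.\<close>
  define F where "F = (\<lambda>x :: real \<times> _. q (fst (snd x), squeeze (fst x) (snd (snd x))))"
  have "continuous_map (prod_topology ?I (prod_topology ?G ?A)) (prod_topology ?G ?A)
      (\<lambda>x. (fst (snd x), squeeze (fst x) (snd (snd x))))"
  proof (rule continuous_map_pairedI)
    show "continuous_map (prod_topology ?I (prod_topology ?G ?A)) ?G (\<lambda>x. fst (snd x))"
      using continuous_map_compose[OF continuous_map_snd continuous_map_fst] by (simp add: o_def)
    have "continuous_map (prod_topology ?I (prod_topology ?G ?A)) (prod_topology ?I ?A) (\<lambda>x. (fst x, snd (snd x)))"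
      using continuous_map_compose[OF continuous_map_snd continuous_map_snd]
      by (intro continuous_map_pairedI continuous_map_fst) (simp add: o_def)
    from continuous_map_compose[OF this continuous_map_squeeze]
    show "continuous_map (prod_topology ?I (prod_topology ?G ?A)) ?A (\<lambda>x. squeeze (fst x) (snd (snd x)))"
      by (simp add: o_def)
  qed
  from continuous_map_compose[OF this quotient_imp_continuous_map[OF q]]
  have F: "continuous_map (prod_topology ?I (prod_topology ?G ?A)) ?X F"
    by (simp add: o_def F_def)
  have "F x = F y" if x: "x \<in> topspace (prod_topology ?I (prod_topology ?G ?A))"
      and y: "y \<in> topspace (prod_topology ?I (prod_topology ?G ?A))" and e: "Q x = Q y" for x y
  proof -
    obtain s g z where xs: "x = (s, (g, z))" by (metis prod.collapse)
    obtain t h w where yt: "y = (t, (h, w))" by (metis prod.collapse)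
    have *: "s = t" "q (g, z) = q (h, w)" using e by (auto simp: Q_def xs yt)
    have m: "s \<in> {0..1}" "g \<in> U0_hat v" "z \<in> cpt_apartment" "h \<in> U0_hat v" "w \<in> cpt_apartment"
      using x y by (auto simp: xs yt)
    then have "((g, z), (h, w)) \<in> ?R" using *(2) q_eq by blast
    then have "((g, squeeze s z), (h, squeeze s w)) \<in> ?R" using m(1) by (rule building_rel_squeeze)
    then have "q (g, squeeze s z) = q (h, squeeze s w)"
      using squeeze_closed[OF m(3,1)] squeeze_closed[OF m(5,1)] m by (subst q_eq) simp_all
    then show ?thesis by (simp add: F_def xs yt *(1)[symmetric])
  qed
  then obtain H where H: "continuous_map (prod_topology ?I ?X) ?X H"
    and HQ: "\<And>x. x \<in> topspace (prod_topology ?I (prod_topology ?G ?A)) \<Longrightarrow> H (Q x) = F x"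
    using quotient_map_lift_exists[OF Q F] by metis
  have Hq: "H (s, q a) = q (fst a, squeeze s (snd a))"
    if "s \<in> {0..1}" "a \<in> topspace (prod_topology ?G ?A)" for s a
    using HQ[of "(s, a)"] that by (auto simp: Q_def F_def)
  have surj: "\<exists>a \<in> topspace (prod_topology ?G ?A). c = q a" if "c \<in> topspace ?X" for c
    using quotient_imp_surjective_map[OF q] that by blast
  let ?o = "hpt (\<chi> i. 1) :: 'n apt_point"
  have o: "?o \<in> cpt_apartment" using pt_0_cpt by (simp add: pt_0)
  obtain c0 where c0: "\<And>g. g \<in> U0_hat v \<Longrightarrow> q (g, ?o) = c0"
    using building_rel_origin q_eq o by (metis SigmaI)
  have "homotopic_with (\<lambda>x. True) ?X ?X id (\<lambda>x. c0)"
  proof (subst homotopic_with)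
    show "\<exists>H. continuous_map (prod_topology ?I ?X) ?X H \<and> (\<forall>x\<in>topspace ?X. H (0, x) = id x) \<and>
        (\<forall>x\<in>topspace ?X. H (1, x) = c0) \<and> (\<forall>t\<in>{0..1}. True)"
    proof (intro exI[of _ H] conjI ballI H)
      fix c assume "c \<in> topspace ?X"
      then obtain a where a: "a \<in> topspace (prod_topology ?G ?A)" "c = q a" using surj by blast
      show "H (0, c) = id c" using Hq[of 0 a] a top[OF a(1)] by (simp add: squeeze_0)
      show "H (1, c) = c0" using Hq[of 1 a] a top[OF a(1)] c0 by (simp add: squeeze_1)
    qed simp
  qed simp
  then show ?thesis unfolding contractible_space_def by blast
qed

end

lemma (in padic_field) valued_field: "valued_field v"
  using v_zero v_int v_mult v_add by unfold_locales blast+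

theorem theorem5p6:
  fixes p :: nat and v :: "'k::field \<Rightarrow> ereal"
  assumes "padic_field p v"
  shows "contractible_space
           (compactified_building v :: (('k^'n::finite^'n) set \<times> 'n apt_point) set topology)"
proof -
  interpret valued_field v using assms by (rule padic_field.valued_field)
  show ?thesis by (rule contractible_compactified_building)
qed

end
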